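(* There is a polynomial-time approximation scheme for HL$_1$ on trees: for every fixed $\varepsilon\in(0,1)$ there is an algorithm that, given a tree $T$ on $n$ vertices, outputs a hub labeling $H$ of $T$ with $\sum_u|H_u|\le(1+\varepsilon)\cdot OPT$ in time $n^{O(1/\varepsilon)}$, where $OPT$ is the minimum of $\sum_u|H'_u|$ over all hub labelings $H'$ of $T$.
   Context: For a tree $T=(V,E)$ and $u,v\in V$, let $P_{uv}$ be the vertex set of the unique $u$–$v$ path ($P_{uu}=\{u\}$). A hub labeling of $T$ is a family $\{H_u\}_{u\in V}$ of subsets of $V$ with $H_u\cap H_v\cap P_{uv}\neq\varnothing$ for all $u,v\in V$ (including $u=v$). HL$_1$ is the problem of minimizing $\sum_{u\in V}|H_u|$. *)

theory Defs
  imports Complex_Main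
begin

section \<open>Trees and hub labelings\<close>

text \<open>
  A graph is given by a vertex set \<open>V\<close> and a set \<open>E\<close> of two-element subsets of \<open>V\<close>.
  The AFP notion \<open>Digraph_Component.tree\<close> is not usable here: it only excludes directed
  cycles, so it accepts a diamond-shaped DAG and rejects every symmetric digraph with an edge.
\<close>

definition simple_graph :: "'a set \<Rightarrow> 'a set set \<Rightarrow> bool" where
  "simple_graph V E \<longleftrightarrow> finite V \<and> (\<forall>e\<in>E. \<exists>u\<in>V. \<exists>v\<in>V. u \<noteq> v \<and> e = {u, v})"

definition is_path :: "'a set \<Rightarrow> 'a set set \<Rightarrow> 'a list \<Rightarrow> bool" where
  "is_path V E p \<longleftrightarrow>
     p \<noteq> [] \<and> set p \<subseteq> V \<and> distinct p \<and> successively (\<lambda>x y. {x, y} \<in> E) p"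

definition path_between :: "'a set \<Rightarrow> 'a set set \<Rightarrow> 'a \<Rightarrow> 'a \<Rightarrow> 'a list \<Rightarrow> bool" where
  "path_between V E u v p \<longleftrightarrow> is_path V E p \<and> hd p = u \<and> last p = v"

definition is_cycle :: "'a set \<Rightarrow> 'a set set \<Rightarrow> 'a list \<Rightarrow> bool" where
  "is_cycle V E p \<longleftrightarrow> is_path V E p \<and> length p \<ge> 3 \<and> {last p, hd p} \<in> E"

definition is_tree :: "'a set \<Rightarrow> 'a set set \<Rightarrow> bool" where
  "is_tree V E \<longleftrightarrow> simple_graph V E \<and> V \<noteq> {}
     \<and> (\<forall>u\<in>V. \<forall>v\<in>V. \<exists>p. path_between V E u v p)
     \<and> (\<nexists>p. is_cycle V E p)"

definition path_verts :: "'a set \<Rightarrow> 'a set set \<Rightarrow> 'a \<Rightarrow> 'a \<Rightarrow> 'a set" where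
  "path_verts V E u v = set (THE p. path_between V E u v p)"

definition hub_labeling :: "'a set \<Rightarrow> 'a set set \<Rightarrow> ('a \<Rightarrow> 'a set) \<Rightarrow> bool" where
  "hub_labeling V E H \<longleftrightarrow> (\<forall>u\<in>V. H u \<subseteq> V)
     \<and> (\<forall>u\<in>V. \<forall>v\<in>V. H u \<inter> H v \<inter> path_verts V E u v \<noteq> {})"

definition hl1_cost :: "'a set \<Rightarrow> ('a \<Rightarrow> 'a set) \<Rightarrow> nat" where
  "hl1_cost V H = (\<Sum>u\<in>V. card (H u))"

definition hl1_opt :: "'a set \<Rightarrow> 'a set set \<Rightarrow> nat" where
  "hl1_opt V E = (LEAST k. \<exists>H. hub_labeling V E H \<and> hl1_cost V H = k)"


section \<open>Model of computation\<close>

text \<open>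
  Algorithms are programs of a first-order, call-by-value functional language over natural
  numbers and cons cells; a program is a finite list of mutually recursive one-argument
  functions. Running time is the number of evaluation steps, each of which performs at most
  one constant-size operation on numbers or pointers (cons, projection, addition,
  truncated subtraction, comparison). There is no multiplication, so after \<open>t\<close> steps every
  number has at most \<open>t\<close> bits more than the largest number in the input or the program. With
  values stored as shared heap cells, a program is therefore simulated by a random access
  machine or a Turing machine with polynomial overhead, and conversely.
\<close>

datatype val = VNum nat | VPair val val

text \<open>
  \<open>EVar i\<close> is a de Bruijn index into the environment, \<open>ELet a b\<close> evaluates \<open>b\<close> with the value
  of \<open>a\<close> pushed, and \<open>ECall f a\<close> evaluates the \<open>f\<close>-th function body with the value of
  \<open>a\<close> as its whole environment. Tests return 1 or 0, and \<open>EIf\<close> takes the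
  else-branch exactly on 0. Expressions that go wrong have no value.
\<close>

datatype expr =
    EVar nat
  | ENum nat
  | EAdd expr expr
  | ESub expr expr
  | ELess expr expr
  | EPair expr expr
  | EFst expr
  | ESnd expr
  | EIsPair expr
  | EIf expr expr expr
  | ELet expr expr
  | ECall nat expr

type_synonym program = "expr list"

inductive eval :: "program \<Rightarrow> val list \<Rightarrow> expr \<Rightarrow> val \<Rightarrow> nat \<Rightarrow> bool" for P where
  Var: "i < length env \<Longrightarrow> eval P env (EVar i) (env ! i) 1"
| Num: "eval P env (ENum k) (VNum k) 1"
| Add: "eval P env a (VNum x) s \<Longrightarrow> eval P env b (VNum y) t \<Longrightarrow>
    eval P env (EAdd a b) (VNum (x + y)) (s + t + 1)"
| Sub: "eval P env a (VNum x) s \<Longrightarrow> eval P env b (VNum y) t \<Longrightarrow>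
    eval P env (ESub a b) (VNum (x - y)) (s + t + 1)"
| Less: "eval P env a (VNum x) s \<Longrightarrow> eval P env b (VNum y) t \<Longrightarrow>
    eval P env (ELess a b) (VNum (if x < y then 1 else 0)) (s + t + 1)"
| Pair: "eval P env a x s \<Longrightarrow> eval P env b y t \<Longrightarrow>
    eval P env (EPair a b) (VPair x y) (s + t + 1)"
| Fst: "eval P env a (VPair x y) t \<Longrightarrow> eval P env (EFst a) x (t + 1)"
| Snd: "eval P env a (VPair x y) t \<Longrightarrow> eval P env (ESnd a) y (t + 1)"
| IsPair: "eval P env a x t \<Longrightarrow>
    eval P env (EIsPair a) (VNum (case x of VNum _ \<Rightarrow> 0 | VPair _ _ \<Rightarrow> 1)) (t + 1)"
| IfTrue: "eval P env c (VNum k) s \<Longrightarrow> k \<noteq> 0 \<Longrightarrow> eval P env a x t \<Longrightarrow>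
    eval P env (EIf c a b) x (s + t + 1)"
| IfFalse: "eval P env c (VNum 0) s \<Longrightarrow> eval P env b x t \<Longrightarrow>
    eval P env (EIf c a b) x (s + t + 1)"
| Let: "eval P env a x s \<Longrightarrow> eval P (x # env) b y t \<Longrightarrow>
    eval P env (ELet a b) y (s + t + 1)"
| Call: "eval P env a x s \<Longrightarrow> f < length P \<Longrightarrow> eval P [x] (P ! f) y t \<Longrightarrow>
    eval P env (ECall f a) y (s + t + 1)"

inductive_cases eval_VarE: "eval P env (EVar i) x t"
inductive_cases eval_NumE: "eval P env (ENum k) x t"
inductive_cases eval_AddE: "eval P env (EAdd a b) x t"
inductive_cases eval_SubE: "eval P env (ESub a b) x t"
inductive_cases eval_LessE: "eval P env (ELess a b) x t"
inductive_cases eval_PairE: "eval P env (EPair a b) x t"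
inductive_cases eval_FstE: "eval P env (EFst a) x t"
inductive_cases eval_SndE: "eval P env (ESnd a) x t"
inductive_cases eval_IsPairE: "eval P env (EIsPair a) x t"
inductive_cases eval_IfE: "eval P env (EIf c a b) x t"
inductive_cases eval_LetE: "eval P env (ELet a b) x t"
inductive_cases eval_CallE: "eval P env (ECall f a) x t"

lemma eval_deterministic:
  "eval P env e x s \<Longrightarrow> eval P env e y t \<Longrightarrow> x = y \<and> s = t"
proof (induction arbitrary: y t rule: eval.induct)
  case Var
  show ?case
    by (rule eval_VarE[OF Var.prems]) simp_all
next
  case Num
  show ?case
    by (rule eval_NumE[OF Num.prems]) simp_all
next
  case Add
  show ?case
    by (rule eval_AddE[OF Add.prems]) (auto dest!: Add.IH)
next
  case Sub
  show ?case
    by (rule eval_SubE[OF Sub.prems]) (auto dest!: Sub.IH)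
next
  case Less
  show ?case
    by (rule eval_LessE[OF Less.prems]) (auto dest!: Less.IH)
next
  case Pair
  show ?case
    by (rule eval_PairE[OF Pair.prems]) (auto dest!: Pair.IH)
next
  case Fst
  show ?case
    by (rule eval_FstE[OF Fst.prems]) (auto dest!: Fst.IH)
next
  case Snd
  show ?case
    by (rule eval_SndE[OF Snd.prems]) (auto dest!: Snd.IH)
next
  case IsPair
  show ?case
    by (rule eval_IsPairE[OF IsPair.prems]) (auto dest!: IsPair.IH)
next
  case IfTrue
  show ?case
    by (rule eval_IfE[OF IfTrue.prems]) (use IfTrue.hyps(2) in \<open>auto dest!: IfTrue.IH\<close>)
next
  case IfFalse
  show ?case
    by (rule eval_IfE[OF IfFalse.prems]) (auto dest!: IfFalse.IH)
next
  case Let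
  show ?case
    by (rule eval_LetE[OF Let.prems]) (auto dest!: Let.IH)
next
  case Call
  show ?case
    by (rule eval_CallE[OF Call.prems]) (auto dest!: Call.IH)
qed

text \<open>Execution starts in the body of function 0, with the input as its argument.\<close>

definition run_program :: "program \<Rightarrow> val \<Rightarrow> val \<Rightarrow> nat \<Rightarrow> bool" where
  "run_program P inp out t \<longleftrightarrow> P \<noteq> [] \<and> eval P [inp] (P ! 0) out t"


section \<open>Input and output format\<close>

primrec enc_list :: "('a \<Rightarrow> val) \<Rightarrow> 'a list \<Rightarrow> val" where
  "enc_list f [] = VNum 0"
| "enc_list f (x # xs) = VPair (f x) (enc_list f xs)"

text \<open>
  The input is the number \<open>n\<close> of vertices, the vertices being \<open>0, \<dots>, n - 1\<close>, and a list of
  edges in which each edge occurs once, in arbitrary order and orientation.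
\<close>

definition edge_set :: "('a \<times> 'a) list \<Rightarrow> 'a set set" where
  "edge_set es = (\<lambda>(u, v). {u, v}) ` set es"

definition tree_input :: "nat \<Rightarrow> (nat \<times> nat) list \<Rightarrow> bool" where
  "tree_input n es \<longleftrightarrow>
     is_tree {..<n} (edge_set es) \<and> distinct (map (\<lambda>(u, v). {u, v}) es)"

definition enc_tree :: "nat \<Rightarrow> (nat \<times> nat) list \<Rightarrow> val" where
  "enc_tree n es = VPair (VNum n) (enc_list (\<lambda>(u, v). VPair (VNum u) (VNum v)) es)"

text \<open>A labeling of \<open>{..<n}\<close> is output as the list of its \<open>n\<close> hub sets, each given as a list.\<close>

definition enc_labels :: "nat list list \<Rightarrow> val" where
  "enc_labels = enc_list (enc_list VNum)"

definition labels_of :: "nat list list \<Rightarrow> nat \<Rightarrow> nat set" where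
  "labels_of hs u = set (hs ! u)"

end

theory Submission
  imports Defs
begin

text \<open>
  The pieces of a recursive decomposition of the tree are the components \<open>C\<close> of \<open>V - S\<close>; choosing
  a root \<open>r\<close> of \<open>C\<close> makes \<open>r\<close> a hub of all vertices of \<open>C\<close>, and the components of \<open>C - {r}\<close> are
  treated recursively. Such decompositions of least cost among those whose pieces all have \<open>card S \<le> k\<close>
  are found by dynamic programming over \<open>n ^ O(k)\<close> pieces.

  Given an optimal labeling \<open>H\<close>, the sets \<open>H u \<inter> C\<close> for \<open>u \<in> C\<close> intersect pairwise, so by a Helly
  argument some \<open>r\<close> is such that no \<open>H u \<inter> C\<close> lies in one component of \<open>C - {r}\<close>. With such roots each
  vertex \<open>u\<close> receives at most \<open>card (H u)\<close> hubs. Whenever \<open>S\<close> has reached the size \<open>k = 2 * q + 2\<close>, a root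
  that halves \<open>S\<close> is inserted instead; at least \<open>q\<close> ordinary roots on the way to \<open>u\<close> pay for it, hence
  the factor \<open>1 + 1 / q\<close>.
\<close>

section \<open>Trees\<close>

text \<open>The labeling \<open>H\<close> occurs only in the analysis: it certifies that one cheap
  decomposition exists, and the table entry that is returned is never more expensive. Both root
  choices rest on the same Helly argument. Hub sets meet because of the labeling condition; vertex
  sets that see more than half of \<open>S\<close> meet because a vertex outside a connected piece
  of a tree has at most one neighbour in it. A halving root helps only because a subpiece may forget
  the members of \<open>S\<close> that it does not touch. So \<open>S\<close> is any set whose
  complement has the piece as a component, not the record of all roots chosen so far. The obstacle
  for the running time is uniformity: a separate program for each \<open>k\<close>, with a
  polynomial degree of its own, would leave the exponent uncontrolled as \<epsilon> tends to 0.
  Hence \<open>k\<close> is an argument of a single function, computable with one fixed degree in a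
  size parameter \<open>M\<close>, and every bound on intermediate data is stated in terms of
  \<open>M\<close>. The choice \<open>(n + 1) ^ (k + 2)\<close> for \<open>M\<close> then yields an
  exponent linear in \<open>k\<close>.\<close>

definition reach :: "'a set \<Rightarrow> 'a set set \<Rightarrow> 'a \<Rightarrow> 'a \<Rightarrow> bool" where
  "reach A E u v \<longleftrightarrow> (\<exists>p. path_between A E u v p)"

definition connected_in :: "'a set set \<Rightarrow> 'a set \<Rightarrow> bool" where
  "connected_in E A \<longleftrightarrow> (\<forall>u\<in>A. \<forall>v\<in>A. reach A E u v)"

text \<open>\<open>E\<close> is never restricted: the vertex set \<open>A\<close> alone selects the
  induced subgraph. Maximality is expressed by closure under edges within \<open>A\<close>, which
  can be checked locally and carried along paths.\<close>

definition component :: "'a set set \<Rightarrow> 'a set \<Rightarrow> 'a set \<Rightarrow> bool" where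
  "component E A D \<longleftrightarrow> D \<noteq> {} \<and> D \<subseteq> A \<and> connected_in E D
     \<and> (\<forall>x\<in>D. \<forall>y\<in>A. {x, y} \<in> E \<longrightarrow> y \<in> D)"

definition acyclic_graph :: "'a set \<Rightarrow> 'a set set \<Rightarrow> bool" where
  "acyclic_graph V E \<longleftrightarrow> (\<nexists>p. is_cycle V E p)"

text \<open>If the paths leave \<open>u\<close> through different neighbours, the first vertex
  \<open>z\<close> of \<open>p\<close> that also lies on \<open>q'\<close> closes a cycle: to
  \<open>z\<close> along one path and back along the other. Taking the first meeting point makes
  this closed walk simple.\<close>

lemma path_between_unique:
  assumes acyclic: "acyclic_graph V E"
    and "path_between V E u v p" "path_between V E u v q"
  shows "p = q"
  using assms(2,3)
proof (induction p arbitrary: u q)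
  case Nil
  then show ?case by (simp add: path_between_def is_path_def)
next
  case (Cons x p)
  obtain q' where q: "q = u # q'"
    using Cons.prems by (cases q) (auto simp: path_between_def is_path_def)
  have x: "x = u"
    using Cons.prems by (simp add: path_between_def)
  show ?case
  proof (cases "p = [] \<or> q' = []")
    case True
    then show ?thesis
      using Cons.prems x q
      by (cases p; cases q') (auto simp: path_between_def is_path_def split: if_splits)
  next
    case False
    then obtain a p' b q'' where p: "p = a # p'" and q': "q' = b # q''"
      by (meson list.exhaust)
    have pb: "path_between V E a v p" "path_between V E b v q'"
      using Cons.prems x q False p q'
      by (auto simp: path_between_def is_path_def)
    show ?thesis
    proof (cases "a = b")
      case True
      then show ?thesis using Cons.IH[of a q'] pb x q by simp
    next
      case ab: False
      have "v \<in> set p" "v \<in> set q'"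
        using pb False by (metis path_between_def last_in_set)+
      then obtain p1 z p2 where ps: "p = p1 @ z # p2" and z: "z \<in> set q'"
        and p1: "\<forall>y\<in>set p1. y \<notin> set q'"
        using split_list_first_prop[of p "\<lambda>y. y \<in> set q'"] by blast
      obtain q1 q2 where qs: "q' = q1 @ z # q2"
        using z by (auto dest: split_list)
      let ?c = "u # p1 @ [z] @ rev q1"
      have suc: "successively (\<lambda>x y. {x, y} \<in> E) (u # p1 @ [z])"
        "successively (\<lambda>x y. {x, y} \<in> E) (u # q1 @ [z])"
        using Cons.prems x q ps qs
        by (auto simp: path_between_def is_path_def successively_append_iff successively_Cons
            hd_append split: if_splits)
      have "successively (\<lambda>x y. {x, y} \<in> E) (rev (u # q1 @ [z]))"
        unfolding successively_rev using suc(2) by (simp add: insert_commute)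
      then have suc': "successively (\<lambda>x y. {x, y} \<in> E) ([z] @ rev q1)"
        "{last (z # rev q1), u} \<in> E"
        by (auto simp: successively_append_iff successively_Cons hd_append split: if_splits)
      have "is_path V E ?c"
        unfolding is_path_def
      proof (intro conjI)
        show "set ?c \<subseteq> V" "distinct ?c"
          using Cons.prems x q ps qs p1 by (auto simp: path_between_def is_path_def)
        show "successively (\<lambda>x y. {x, y} \<in> E) ?c"
          using suc(1) suc'(1) by (auto simp: successively_append_iff successively_Cons
              hd_append split: if_splits)
      qed simp
      \<comment> \<open>Were both segments empty, \<open>z\<close> would be the second vertex of
        both paths, against \<open>a \<noteq> b\<close>; so the cycle has at least three
        vertices.\<close>
      moreover have "p1 \<noteq> [] \<or> q1 \<noteq> []"
        using ab p q' ps qs by auto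
      then have "length ?c \<ge> 3" by (cases p1; cases q1) auto
      moreover have "{last ?c, hd ?c} \<in> E" using suc'(2) by simp
      ultimately have "is_cycle V E ?c" by (simp add: is_cycle_def)
      then show ?thesis using acyclic by (auto simp: acyclic_graph_def)
    qed
  qed
qed

section \<open>Induced reachability and components\<close>

lemma connected_in_path:
  assumes "connected_in E A" "u \<in> A" "v \<in> A"
  obtains p where "path_between A E u v p"
  using assms unfolding connected_in_def reach_def by blast

lemma path_between_mono: "path_between A E u v p \<Longrightarrow> A \<subseteq> B \<Longrightarrow> path_between B E u v p"
  by (auto simp: path_between_def is_path_def)

lemma path_between_restrict:
  "path_between A E u v p \<Longrightarrow> set p \<subseteq> B \<Longrightarrow> path_between B E u v p"
  by (auto simp: path_between_def is_path_def)

lemma path_between_subset: "path_between A E u v p \<Longrightarrow> set p \<subseteq> A"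
  by (auto simp: path_between_def is_path_def)

lemma path_between_ends: "path_between A E u v p \<Longrightarrow> u \<in> set p \<and> v \<in> set p"
  by (auto simp: path_between_def is_path_def)

lemma path_between_snoc:
  "path_between A E u v p \<Longrightarrow> {v, w} \<in> E \<Longrightarrow> w \<in> A \<Longrightarrow> w \<notin> set p \<Longrightarrow> path_between A E u w (p @ [w])"
  by (auto simp: path_between_def is_path_def successively_append_iff)

lemma reach_mono: "reach A E u v \<Longrightarrow> A \<subseteq> B \<Longrightarrow> reach B E u v"
  unfolding reach_def using path_between_mono by metis

lemma reach_refl: "u \<in> A \<Longrightarrow> reach A E u u"
  unfolding reach_def
  by (rule exI[of _ "[u]"]) (simp add: path_between_def is_path_def)

lemma reach_in: "reach A E u v \<Longrightarrow> u \<in> A \<and> v \<in> A"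
  unfolding reach_def using path_between_subset path_between_ends by (metis subsetD)

text \<open>Reachability means simple paths, so a walk that returns to a vertex of \<open>p\<close>
  has to be cut there.\<close>

lemma reach_step:
  assumes "reach A E u v" "{v, w} \<in> E" "w \<in> A"
  shows "reach A E u w"
proof -
  obtain p where p: "path_between A E u v p"
    using assms(1) by (auto simp: reach_def)
  show ?thesis
  proof (cases "w \<in> set p")
    case True
    then obtain p1 p2 where "p = p1 @ w # p2" by (auto dest: split_list)
    then have "path_between A E u w (p1 @ [w])"
      using p by (auto simp: path_between_def is_path_def successively_append_iff hd_append
          split: if_splits)
    then show ?thesis by (auto simp: reach_def)
  next
    case False
    then show ?thesis
      using path_between_snoc[OF p assms(2,3)] by (auto simp: reach_def)
  qed
qed

text \<open>Makes reachability by simple paths usable like a reflexive transitive closure: facts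
  propagate edge by edge, without vertex lists.\<close>

lemma reach_induct [consumes 1, case_names refl step]:
  assumes "reach A E u v"
    and "u \<in> A \<Longrightarrow> P u"
    and "\<And>x y. reach A E u x \<Longrightarrow> P x \<Longrightarrow> y \<in> A \<Longrightarrow> {x, y} \<in> E \<Longrightarrow> P y"
  shows "P v"
proof -
  have "path_between A E u v p \<Longrightarrow> P v" for p
  proof (induction p arbitrary: v rule: rev_induct)
    case Nil
    then show ?case by (simp add: path_between_def is_path_def)
  next
    case (snoc x xs)
    show ?case
    proof (cases "xs = []")
      case True
      then show ?thesis using snoc.prems assms(2) by (auto simp: path_between_def is_path_def)
    next
      case False
      then have "path_between A E u (last xs) xs" "{last xs, v} \<in> E" "v \<in> A"
        using snoc.prems
        by (auto simp: path_between_def is_path_def successively_append_iff)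
      then show ?thesis using snoc.IH assms(3) by (auto simp: reach_def)
    qed
  qed
  then show ?thesis using assms(1) by (auto simp: reach_def)
qed

lemma reach_trans: "reach A E v w \<Longrightarrow> reach A E u v \<Longrightarrow> reach A E u w"
proof (induction rule: reach_induct)
  case (step x y)
  then show ?case by (simp add: reach_step[of A E u x y])
qed

lemma reach_sym: "reach A E u v \<Longrightarrow> reach A E v u"
proof (induction rule: reach_induct)
  case refl
  then show ?case by (rule reach_refl)
next
  case (step x y)
  have "{y, x} \<in> E" "x \<in> A"
    using step.hyps(3) reach_in[OF step.hyps(1)] by (simp_all add: insert_commute)
  then have "reach A E y x" by (rule reach_step[OF reach_refl[OF step.hyps(2)]])
  then show ?case by (rule reach_trans[OF step.IH])
qed

lemma component_absorbs:
  assumes "component E A D" "connected_in E B" "B \<subseteq> A" "x \<in> B" "x \<in> D"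
  shows "B \<subseteq> D"
proof
  fix y assume "y \<in> B"
  then have "reach B E x y" using assms by (simp add: connected_in_def)
  then show "y \<in> D"
  proof (induction rule: reach_induct)
    case refl
    show ?case by fact
  next
    case (step z w)
    then show ?case using assms(1,3) by (auto simp: component_def)
  qed
qed

lemma component_eq_reach:
  assumes "component E A D" "v \<in> D"
  shows "D = {w. reach A E v w}"
proof
  have "reach D E v w" if "w \<in> D" for w
    using assms that by (simp add: component_def connected_in_def)
  then show "D \<subseteq> {w. reach A E v w}"
    using assms by (auto simp: component_def dest: reach_mono)
  have "w \<in> D" if "reach A E v w" for w
    using that by (induction rule: reach_induct) (use assms in \<open>auto simp: component_def\<close>)
  then show "{w. reach A E v w} \<subseteq> D" by auto
qed

lemma component_reach:
  assumes "v \<in> A"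
  shows "component E A {w. reach A E v w}"
proof -
  let ?D = "{w. reach A E v w}"
  have *: "reach ?D E v w" if "reach A E v w" for w
    using that
  proof (induction rule: reach_induct)
    case refl
    then show ?case by (simp add: reach_refl)
  next
    case (step x y)
    from step.hyps have "reach A E v y" by (simp add: reach_step[of A E v x y])
    then show ?case using reach_step[OF step.IH step.hyps(3)] by simp
  qed
  have "connected_in E ?D"
    unfolding connected_in_def
  proof (intro ballI)
    fix x y assume "x \<in> ?D" "y \<in> ?D"
    then show "reach ?D E x y" using reach_trans[OF * reach_sym[OF *]] by simp
  qed
  then show ?thesis
    unfolding component_def
    using reach_refl[OF assms, of E] reach_in[of A E v] reach_step[of A E v] by blast
qed

lemma components_disjoint:
  assumes "component E A D" "component E A D'" "x \<in> D" "x \<in> D'"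
  shows "D = D'"
  using component_eq_reach assms by metis

text \<open>\<open>S'\<close> may drop every member of \<open>S\<close> without a neighbour in
  \<open>D\<close>. This freedom lets the boundary shrink at a halving root;
  \<open>S' = insert r S\<close> serves for ordinary roots. A neighbour of \<open>D\<close> outside
  \<open>S'\<close> is not in \<open>S\<close> by \<open>nb\<close>, hence lies in \<open>C\<close>,
  and it differs from \<open>r\<close>, hence lies in \<open>D\<close>.\<close>

lemma component_of_component:
  assumes C: "component E (V - S) C" and D: "component E (C - {r}) D"
    and S': "r \<in> S'" "S' \<subseteq> insert r S" and "C \<subseteq> V"
    and nb: "\<And>s x. s \<in> S \<Longrightarrow> x \<in> D \<Longrightarrow> {x, s} \<in> E \<Longrightarrow> s \<in> S'"
  shows "component E (V - S') D"
  unfolding component_def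
proof (intro conjI ballI impI)
  show "D \<noteq> {}" "connected_in E D" using D by (auto simp: component_def)
  show "D \<subseteq> V - S'" using C D S' by (auto simp: component_def)
next
  fix x y assume xy: "x \<in> D" "y \<in> V - S'" "{x, y} \<in> E"
  then have "y \<notin> S" using nb by auto
  then have "y \<in> C" using C D xy by (auto simp: component_def)
  then show "y \<in> D" using D S' xy by (auto simp: component_def)
qed

text \<open>On the way from \<open>D\<close> to \<open>r\<close> within \<open>C\<close>, the walk
  can leave \<open>D\<close> only into \<open>r\<close>, as \<open>D\<close> is closed in
  \<open>C - {r}\<close>.\<close>

lemma component_neighbour:
  assumes "connected_in E C" "r \<in> C" "component E (C - {r}) D"
  obtains x where "x \<in> D" "{r, x} \<in> E"
proof -
  obtain z where z: "z \<in> D" using assms by (auto simp: component_def)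
  have "reach C E z r" using assms z by (auto simp: component_def connected_in_def)
  moreover have "y \<in> D \<or> (\<exists>x\<in>D. {r, x} \<in> E)" if "reach C E z y" for y
    using that
  proof (induction rule: reach_induct)
    case refl
    then show ?case using z by simp
  next
    case (step x y)
    from step.IH show ?case
    proof
      assume x: "x \<in> D"
      show ?thesis
      proof (cases "y = r")
        case True
        then have "{r, x} \<in> E" using step.hyps(3) by (simp add: insert_commute)
        then show ?thesis using x by blast
      next
        case False
        then have "y \<in> C - {r}" using step.hyps(2) by simp
        then have "y \<in> D" using x step.hyps(3) assms(3) unfolding component_def by blast
        then show ?thesis ..
      qed
    qed blast
  qed
  moreover have "r \<notin> D" using assms(3) by (auto simp: component_def)
  ultimately show ?thesis using that by blast
qed

section \<open>Paths and separators in trees\<close>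

lemma acyclic_graph_path_verts:
  assumes "acyclic_graph V E" "path_between V E u v p"
  shows "path_verts V E u v = set p"
proof -
  have "(THE p. path_between V E u v p) = p"
    by (rule the_equality, rule assms(2), rule path_between_unique[OF assms(1) _ assms(2)])
  then show ?thesis by (simp add: path_verts_def)
qed

text \<open>Subtrees are convex: a path inside \<open>C\<close> is also a path of the whole tree,
  hence the unique one.\<close>

lemma path_verts_in_connected:
  assumes "acyclic_graph V E" "C \<subseteq> V" "connected_in E C" "u \<in> C" "v \<in> C"
  shows "path_verts V E u v \<subseteq> C"
proof -
  obtain p where p: "path_between C E u v p"
    using connected_in_path[OF assms(3-5)] .
  then have "path_verts V E u v = set p"
    using acyclic_graph_path_verts path_between_mono assms by metis
  then show ?thesis using path_between_subset[OF p] by simp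
qed

lemma separator_in_path_verts:
  assumes "acyclic_graph V E" "C \<subseteq> V" "connected_in E C" "u \<in> C" "v \<in> C"
    and "\<not> reach (C - {r}) E u v"
  shows "r \<in> path_verts V E u v"
proof (rule ccontr)
  assume r: "r \<notin> path_verts V E u v"
  obtain p where p: "path_between C E u v p"
    using connected_in_path[OF assms(3-5)] .
  then have "path_verts V E u v = set p"
    using acyclic_graph_path_verts path_between_mono assms by metis
  then have "set p \<subseteq> C - {r}" using r path_between_subset[OF p] by auto
  then have "path_between (C - {r}) E u v p" by (rule path_between_restrict[OF p])
  then show False using assms(6) by (auto simp: reach_def)
qed

text \<open>Two neighbours of \<open>s\<close> would give two paths from \<open>a\<close> to
  \<open>s\<close>: the single edge, and the detour through \<open>C\<close> and
  \<open>b\<close>.\<close>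

lemma unique_neighbour:
  assumes "acyclic_graph V E" "C \<subseteq> V" "connected_in E C" "s \<in> V - C"
    and "a \<in> C" "{a, s} \<in> E" "b \<in> C" "{b, s} \<in> E"
  shows "a = b"
proof -
  obtain p where p: "path_between C E a b p"
    using connected_in_path[OF assms(3,5,7)] .
  have "s \<notin> set p" using path_between_subset[OF p] assms by auto
  then have "path_between V E a s (p @ [s])"
    using path_between_snoc[OF path_between_mono[OF p]] assms by auto
  moreover have "path_between V E a s [a, s]"
    using assms by (auto simp: path_between_def is_path_def)
  ultimately have "p @ [s] = [a, s]" using path_between_unique assms(1) by metis
  then show ?thesis using p by (simp add: path_between_def)
qed

text \<open>From a common vertex there would be one path to \<open>r\<close> through
  \<open>D\<close> that ends with the edge from \<open>r'\<close>, and another one inside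
  \<open>D'\<close>, which avoids \<open>r'\<close>.\<close>

lemma opposite_components_disjoint:
  assumes "acyclic_graph V E" "C \<subseteq> V" "r \<in> C" "r' \<in> D" "r \<in> D'" "{r', r} \<in> E"
    and D: "component E (C - {r}) D" and D': "component E (C - {r'}) D'"
  shows "D \<inter> D' = {}"
proof (rule ccontr)
  assume "D \<inter> D' \<noteq> {}"
  then obtain x where x: "x \<in> D" "x \<in> D'" by auto
  obtain p q where p: "path_between D E x r' p" and q: "path_between D' E x r q"
    using x D D' assms by (meson component_def connected_in_path)
  have sub: "set p \<subseteq> C - {r}" "set q \<subseteq> C - {r'}"
    using path_between_subset[OF p] path_between_subset[OF q] D D' by (auto simp: component_def)
  have "path_between V E x r' p" "r \<in> V" "r \<notin> set p"
    using path_between_restrict[OF p] sub assms(2,3) by auto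
  then have "path_between V E x r (p @ [r])"
    using path_between_snoc assms(6) by metis
  moreover have "path_between V E x r q"
    using path_between_restrict[OF q] sub assms(2) by auto
  ultimately have "q = p @ [r]" using path_between_unique assms(1) by metis
  then show False using sub path_between_ends[OF p] by auto
qed

text \<open>
  Helly-type property of trees. If every vertex \<open>r\<close> had a component of \<open>C - {r}\<close> containing a
  member of the family, follow a minimal such component \<open>D\<close> to the neighbour \<open>r'\<close> of \<open>r\<close> in it: the
  component chosen for \<open>r'\<close> either is smaller than \<open>D\<close> or lies on the other side of the edge.
\<close>

lemma pairwise_intersecting_separator:
  assumes "acyclic_graph V E" "C \<subseteq> V" "finite C" "C \<noteq> {}" "connected_in E C"
    and inter: "\<And>A B. A \<in> F \<Longrightarrow> B \<in> F \<Longrightarrow> A \<inter> B \<noteq> {}"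
  shows "\<exists>r\<in>C. \<forall>D A. component E (C - {r}) D \<longrightarrow> A \<in> F \<longrightarrow> \<not> A \<subseteq> D"
proof (rule ccontr)
  let ?bad = "\<lambda>r D. r \<in> C \<and> component E (C - {r}) D \<and> (\<exists>A\<in>F. A \<subseteq> D)"
  assume "\<not> ?thesis"
  then have ex: "\<exists>D. ?bad r D" if "r \<in> C" for r
    using that by blast
  obtain r0 where "r0 \<in> C" using assms(4) by blast
  from ex[OF this] obtain D0 where "?bad r0 D0" ..
  define B where "B = (\<lambda>rD. ?bad (fst rD) (snd rD))"
  have "B (r0, D0)" using \<open>?bad r0 D0\<close> by (simp add: B_def)
  from ex_has_least_nat[of B, OF this, of "\<lambda>rD. card (snd rD)"]
  obtain rD where min: "B rD" "\<forall>y. B y \<longrightarrow> card (snd rD) \<le> card (snd y)"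
    by blast
  obtain r D where rD: "rD = (r, D)" by force
  have D: "r \<in> C" "component E (C - {r}) D" and "\<exists>A\<in>F. A \<subseteq> D"
    using min(1) rD by (simp_all add: B_def)
  from this(3) obtain A where A: "A \<in> F" "A \<subseteq> D" ..
  obtain r' where r': "r' \<in> D" "{r, r'} \<in> E"
    using component_neighbour[OF assms(5) D] .
  then have "r' \<in> C" using D by (auto simp: component_def)
  from ex[OF this]
  obtain D' A' where D': "component E (C - {r'}) D'" and A': "A' \<in> F" "A' \<subseteq> D'"
    by (elim exE conjE bexE) (rule that)
  show False
  proof (cases "r \<in> D'")
    case True
    have "{r', r} \<in> E" using r' by (simp add: insert_commute)
    then have "D \<inter> D' = {}"
      using opposite_components_disjoint[OF assms(1,2) D(1) r'(1) True _ D(2) D'] by simp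
    then show False using inter[OF A(1) A'(1)] A A' by auto
  next
    case False
    obtain x where x: "x \<in> D'" "{r', x} \<in> E"
      using component_neighbour[OF assms(5) \<open>r' \<in> C\<close> D'] .
    \<comment> \<open>\<open>x\<close> is adjacent to \<open>r'\<close> and differs from
      \<open>r\<close>, so it lies in \<open>D\<close>; the rest of \<open>D'\<close> follows, being
      connected and avoiding \<open>r\<close>.\<close>
    have sub: "D' \<subseteq> C - {r}" using D' False by (auto simp: component_def)
    then have "x \<in> D" using x r' D by (auto simp: component_def)
    then have "D' \<subseteq> D"
      using component_absorbs[OF D(2) _ sub x(1)] D' by (auto simp: component_def)
    moreover have "r' \<notin> D'" using D' by (auto simp: component_def)
    moreover have "finite D" using D assms(3) by (auto simp: component_def intro: finite_subset)
    ultimately have "card D' < card D" using r' by (intro psubset_card_mono) auto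
    moreover have "card D \<le> card D'"
      using min(2)[rule_format, of "(r', D')"] rD D' A' \<open>r' \<in> C\<close> by (auto simp: B_def)
    ultimately show False by simp
  qed
qed

section \<open>The two choices of a root\<close>

definition nbrs_in :: "'a set set \<Rightarrow> 'a set \<Rightarrow> 'a set \<Rightarrow> 'a set" where
  "nbrs_in E S D = {s \<in> S. \<exists>x\<in>D. {x, s} \<in> E}"

text \<open>For \<open>u\<close> and \<open>v\<close> in \<open>C\<close>, the common hub demanded
  on their path lies in \<open>C\<close> because the whole path does.\<close>

lemma hub_separator:
  assumes "acyclic_graph V E" "C \<subseteq> V" "finite C" "C \<noteq> {}" "connected_in E C"
    and H: "hub_labeling V E H"
  shows "\<exists>r\<in>C. \<forall>D u. component E (C - {r}) D \<longrightarrow> u \<in> C \<longrightarrow> \<not> H u \<inter> C \<subseteq> D"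
proof -
  have "A \<inter> B \<noteq> {}" if AB: "A \<in> (\<lambda>u. H u \<inter> C) ` C" "B \<in> (\<lambda>u. H u \<inter> C) ` C" for A B
  proof -
    obtain u v where uv: "A = H u \<inter> C" "u \<in> C" "B = H v \<inter> C" "v \<in> C" using AB by auto
    have "u \<in> V" "v \<in> V" using uv assms(2) by auto
    then have "H u \<inter> H v \<inter> path_verts V E u v \<noteq> {}"
      using H by (simp add: hub_labeling_def)
    then show ?thesis using path_verts_in_connected[OF assms(1,2,5) uv(2,4)] uv by auto
  qed
  from pairwise_intersecting_separator[OF assms(1-5) this]
  obtain r where r: "r \<in> C"
    "\<forall>D A. component E (C - {r}) D \<longrightarrow> A \<in> (\<lambda>u. H u \<inter> C) ` C \<longrightarrow> \<not> A \<subseteq> D" ..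
  show ?thesis
    by (intro bexI[OF _ r(1)] allI impI) (rule r(2)[rule_format], assumption, rule imageI)
qed

text \<open>A vertex of \<open>S\<close> has at most one neighbour in \<open>C\<close>. Two subsets
  of \<open>C\<close> that each see more than half of \<open>S\<close> see a common vertex of
  \<open>S\<close> and therefore share its neighbour, so the Helly property applies to such
  subsets.\<close>

lemma boundary_separator:
  assumes "acyclic_graph V E" "C \<subseteq> V" "finite C" "C \<noteq> {}" "connected_in E C"
    and S: "finite S" "S \<subseteq> V - C"
  shows "\<exists>r\<in>C. \<forall>D. component E (C - {r}) D \<longrightarrow> 2 * card (nbrs_in E S D) \<le> card S"
proof -
  let ?F = "{A. A \<subseteq> C \<and> card S < 2 * card (nbrs_in E S A)}"
  have "A \<inter> B \<noteq> {}" if AB: "A \<in> ?F" "B \<in> ?F" for A B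
  proof -
    have sub: "nbrs_in E S A \<subseteq> S" "nbrs_in E S B \<subseteq> S" by (auto simp: nbrs_in_def)
    have "nbrs_in E S A \<inter> nbrs_in E S B \<noteq> {}"
    proof
      assume "nbrs_in E S A \<inter> nbrs_in E S B = {}"
      then have "card (nbrs_in E S A) + card (nbrs_in E S B) = card (nbrs_in E S A \<union> nbrs_in E S B)"
        using sub S(1) by (simp add: card_Un_disjoint finite_subset)
      also have "\<dots> \<le> card S" using sub S(1) by (simp add: card_mono)
      finally show False using AB by simp
    qed
    then obtain s a b where s: "s \<in> S" "a \<in> A" "{a, s} \<in> E" "b \<in> B" "{b, s} \<in> E"
      by (auto simp: nbrs_in_def)
    moreover have "s \<in> V - C" "a \<in> C" "b \<in> C" using s AB S(2) by blast+
    ultimately have "a = b" using unique_neighbour[OF assms(1,2,5)] by metis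
    then show ?thesis using s by auto
  qed
  from pairwise_intersecting_separator[OF assms(1-5) this]
  obtain r where r: "r \<in> C" "\<forall>D A. component E (C - {r}) D \<longrightarrow> A \<in> ?F \<longrightarrow> \<not> A \<subseteq> D" ..
  have "2 * card (nbrs_in E S D) \<le> card S" if D: "component E (C - {r}) D" for D
  proof (rule ccontr)
    assume "\<not> ?thesis"
    moreover have "D \<subseteq> C" using D by (auto simp: component_def)
    ultimately have "D \<in> ?F" by simp
    then show False using r(2)[rule_format, OF D] by blast
  qed
  then show ?thesis using r(1) by blast
qed

section \<open>Polynomial-time computable functions\<close>

text \<open>Encodings of different types overlap: \<open>[]\<close>, \<open>0\<close> and
  \<open>False\<close> all become \<open>VNum 0\<close>. Programs are therefore always related to
  functions of fixed argument and result type.\<close>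

class encodable =
  fixes enc :: "'a \<Rightarrow> val"

instantiation nat :: encodable
begin
definition "enc = VNum"
instance ..
end

instantiation bool :: encodable
begin
definition "enc b = VNum (if b then 1 else 0)"
instance ..
end

instantiation prod :: (encodable, encodable) encodable
begin
definition "enc p = VPair (enc (fst p)) (enc (snd p))"
instance ..
end

instantiation list :: (encodable) encodable
begin
definition "enc xs = enc_list enc xs"
instance ..
end

lemma enc_Pair [simp]: "enc (a, b) = VPair (enc a) (enc b)"
  by (simp add: enc_prod_def)

lemma enc_Nil [simp]: "enc [] = VNum 0"
  by (simp add: enc_list_def)

lemma enc_Cons [simp]: "enc (x # xs) = VPair (enc x) (enc xs)"
  by (simp add: enc_list_def)

section \<open>Evaluation with an upper bound on the number of steps\<close>

text \<open>Step counts are bounded only from above, so that branches and loops of different length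
  can share one bound.\<close>

definition eval_within :: "program \<Rightarrow> val list \<Rightarrow> expr \<Rightarrow> val \<Rightarrow> nat \<Rightarrow> bool" where
  "eval_within P env e v B \<longleftrightarrow> (\<exists>t\<le>B. eval P env e v t)"

lemma eval_within_mono: "eval_within P env e v B \<Longrightarrow> B \<le> B' \<Longrightarrow> eval_within P env e v B'"
  unfolding eval_within_def by (meson le_trans)

lemma eval_within_Var: "i < length env \<Longrightarrow> eval_within P env (EVar i) (env ! i) 1"
  unfolding eval_within_def by (blast intro: eval.Var)

lemma eval_within_Num: "eval_within P env (ENum k) (VNum k) 1"
  unfolding eval_within_def by (blast intro: eval.Num)

lemma eval_within_Add:
  assumes "eval_within P env a (VNum x) s" "eval_within P env b (VNum y) t"
  shows "eval_within P env (EAdd a b) (VNum (x + y)) (s + t + 1)"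
  using assms unfolding eval_within_def by (meson eval.Add add_mono le_refl)

lemma eval_within_Less:
  assumes "eval_within P env a (VNum x) s" "eval_within P env b (VNum y) t"
  shows "eval_within P env (ELess a b) (VNum (if x < y then 1 else 0)) (s + t + 1)"
  using assms unfolding eval_within_def by (meson eval.Less add_mono le_refl)

lemma eval_within_Sub:
  assumes "eval_within P env a (VNum x) s" "eval_within P env b (VNum y) t"
  shows "eval_within P env (ESub a b) (VNum (x - y)) (s + t + 1)"
  using assms unfolding eval_within_def by (meson eval.Sub add_mono le_refl)

lemma eval_within_Pair:
  assumes "eval_within P env a x s" "eval_within P env b y t"
  shows "eval_within P env (EPair a b) (VPair x y) (s + t + 1)"
  using assms unfolding eval_within_def by (meson eval.Pair add_mono le_refl)

lemma eval_within_Fst: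
  assumes "eval_within P env a (VPair x y) s"
  shows "eval_within P env (EFst a) x (s + 1)"
  using assms unfolding eval_within_def by (meson eval.Fst add_mono le_refl)

lemma eval_within_Snd:
  assumes "eval_within P env a (VPair x y) s"
  shows "eval_within P env (ESnd a) y (s + 1)"
  using assms unfolding eval_within_def by (meson eval.Snd add_mono le_refl)

lemma eval_within_IsPair_Num:
  assumes "eval_within P env a (VNum x) s"
  shows "eval_within P env (EIsPair a) (VNum 0) (s + 1)"
proof -
  obtain t where "t \<le> s" "eval P env a (VNum x) t" using assms unfolding eval_within_def by blast
  then show ?thesis using eval.IsPair[of P env a "VNum x" t] unfolding eval_within_def by fastforce
qed

lemma eval_within_IsPair_Pair:
  assumes "eval_within P env a (VPair x y) s"
  shows "eval_within P env (EIsPair a) (VNum 1) (s + 1)"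
proof -
  obtain t where "t \<le> s" "eval P env a (VPair x y) t" using assms unfolding eval_within_def by blast
  then show ?thesis using eval.IsPair[of P env a "VPair x y" t] unfolding eval_within_def by fastforce
qed

lemma eval_within_If:
  assumes "eval_within P env c (VNum (if q then 1 else 0)) s"
    and "q \<Longrightarrow> eval_within P env a x t" "\<not> q \<Longrightarrow> eval_within P env b x t"
  shows "eval_within P env (EIf c a b) x (s + t + 1)"
proof (cases q)
  case True
  then obtain s' t' where "s' \<le> s" "t' \<le> t" "eval P env c (VNum 1) s'" "eval P env a x t'"
    using assms unfolding eval_within_def by auto
  then show ?thesis
    using eval.IfTrue[of P env c 1 s' a x t' b] unfolding eval_within_def
    by (intro exI[of _ "s' + t' + 1"]) simp
next
  case False
  then obtain s' t' where "s' \<le> s" "t' \<le> t" "eval P env c (VNum 0) s'" "eval P env b x t'"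
    using assms unfolding eval_within_def by auto
  then show ?thesis
    using eval.IfFalse[of P env c s' b x t' a] unfolding eval_within_def
    by (intro exI[of _ "s' + t' + 1"]) simp
qed

lemma eval_within_Let:
  assumes "eval_within P env a x s" "eval_within P (x # env) b y t"
  shows "eval_within P env (ELet a b) y (s + t + 1)"
  using assms unfolding eval_within_def by (meson eval.Let add_mono le_refl)

lemma eval_within_Call:
  assumes "eval_within P env a x s" "f < length P" "eval_within P [x] (P ! f) y t"
  shows "eval_within P env (ECall f a) y (s + t + 1)"
  using assms unfolding eval_within_def by (meson eval.Call add_mono le_refl)

text \<open>
  \<open>realizes m R D d f b\<close>: in every program that has the block \<open>R\<close> at position \<open>m\<close>, the
  expression \<open>b\<close> computes \<open>f\<close> from an argument in variable 0, in time polynomial of degree \<open>d\<close> in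
  the size parameter \<open>M\<close> for which the argument satisfies \<open>D\<close>.
\<close>

definition realizes :: "nat \<Rightarrow> program \<Rightarrow> (nat \<Rightarrow> 'c :: encodable \<Rightarrow> bool) \<Rightarrow> nat \<Rightarrow>
    ('c \<Rightarrow> 'r :: encodable) \<Rightarrow> expr \<Rightarrow> bool" where
  "realizes m R D d f b \<longleftrightarrow> (\<forall>Q Q'. length Q = m \<longrightarrow> (\<forall>M c env. D M c \<longrightarrow>
     eval_within (Q @ R @ Q') (enc c # env) b (enc (f c)) ((M + 2) ^ d)))"

text \<open>
  The degree must not depend on the position of the code, but the code may: calls use absolute
  function numbers.
\<close>

definition ptime :: "(nat \<Rightarrow> 'c :: encodable \<Rightarrow> bool) \<Rightarrow> ('c \<Rightarrow> 'r :: encodable) \<Rightarrow> bool" where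
  "ptime D f \<longleftrightarrow> (\<exists>d. \<forall>m. \<exists>R b. realizes m R D d f b)"

section \<open>Relocatable code and polynomial bounds\<close>

lemma realizesD:
  "realizes m R D d f b \<Longrightarrow> length Q = m \<Longrightarrow> D M c \<Longrightarrow>
    eval_within (Q @ R @ Q') (enc c # env) b (enc (f c)) ((M + 2) ^ d)"
  unfolding realizes_def by blast

lemma realizes_mono:
  assumes "realizes m R D d f b" "d \<le> d'"
  shows "realizes m R D d' f b"
  unfolding realizes_def
proof (intro allI impI)
  fix Q Q' :: program and M c env assume "length Q = m" "D M c"
  then show "eval_within (Q @ R @ Q') (enc c # env) b (enc (f c)) ((M + 2) ^ d')"
    by (rule eval_within_mono[OF realizesD[OF assms(1)]]) (use assms(2) in \<open>simp add: power_increasing\<close>)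
qed

lemma realizes_append: "realizes m R D d f b \<Longrightarrow> realizes m (R @ R') D d f b"
  unfolding realizes_def by simp

lemma realizes_prepend:
  assumes "realizes (m + length R') R D d f b"
  shows "realizes m (R' @ R) D d f b"
  unfolding realizes_def
proof (intro allI impI)
  fix Q Q' :: program and M c env assume "length Q = m" "D M c"
  then show "eval_within (Q @ (R' @ R) @ Q') (enc c # env) b (enc (f c)) ((M + 2) ^ d)"
    using realizesD[OF assms, of "Q @ R'" M c Q' env] by simp
qed

text \<open>The code of the second function is generated for the position directly behind the first.
  Raising both degrees to their maximum is legitimate because neither depends on that
  position.\<close>

lemma ptime_joint2:
  assumes "ptime D f" "ptime D' g"
  obtains d where "\<And>m. \<exists>R a b. realizes m R D d f a \<and> realizes m R D' d g b"
proof -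
  obtain d1 where d1: "\<forall>m. \<exists>R b. realizes m R D d1 f b" using assms(1) unfolding ptime_def ..
  obtain d2 where d2: "\<forall>m. \<exists>R b. realizes m R D' d2 g b" using assms(2) unfolding ptime_def ..
  have "\<exists>R a b. realizes m R D (max d1 d2) f a \<and> realizes m R D' (max d1 d2) g b" for m
  proof -
    obtain R1 a where 1: "realizes m R1 D d1 f a" using d1 by blast
    obtain R2 b where 2: "realizes (m + length R1) R2 D' d2 g b" using d2 by blast
    have "realizes m (R1 @ R2) D (max d1 d2) f a"
      by (rule realizes_append[OF realizes_mono[OF 1]]) simp
    moreover have "realizes m (R1 @ R2) D' (max d1 d2) g b"
      by (rule realizes_prepend[OF realizes_mono[OF 2]]) simp
    ultimately show ?thesis by blast
  qed
  then show ?thesis using that by blast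
qed

lemma ptime_joint3:
  assumes "ptime D f" "ptime D' g" "ptime D'' h"
  obtains d where "\<And>m. \<exists>R a b e. realizes m R D d f a \<and> realizes m R D' d g b \<and> realizes m R D'' d h e"
proof -
  obtain d1 where d1: "\<And>m. \<exists>R a b. realizes m R D d1 f a \<and> realizes m R D' d1 g b"
    using ptime_joint2[OF assms(1,2)] by blast
  obtain d2 where d2: "\<forall>m. \<exists>R b. realizes m R D'' d2 h b" using assms(3) unfolding ptime_def ..
  have "\<exists>R a b e. realizes m R D (max d1 d2) f a \<and> realizes m R D' (max d1 d2) g b
      \<and> realizes m R D'' (max d1 d2) h e" for m
  proof -
    obtain R1 a b where 1: "realizes m R1 D d1 f a" "realizes m R1 D' d1 g b" using d1 by blast
    obtain R2 e where 2: "realizes (m + length R1) R2 D'' d2 h e" using d2 by blast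
    have "realizes m (R1 @ R2) D (max d1 d2) f a" "realizes m (R1 @ R2) D' (max d1 d2) g b"
      by (rule realizes_append[OF realizes_mono[OF 1(1)]], simp)
        (rule realizes_append[OF realizes_mono[OF 1(2)]], simp)
    moreover have "realizes m (R1 @ R2) D'' (max d1 d2) h e"
      by (rule realizes_prepend[OF realizes_mono[OF 2]]) simp
    ultimately show ?thesis by blast
  qed
  then show ?thesis using that by blast
qed

text \<open>The base \<open>M + 2\<close> is at least 2 even for \<open>M = 0\<close>, so a constant
  factor and a constant summand cost only a constant number of further degrees.\<close>

lemma power_bound_linear:
  fixes M :: nat
  assumes "a + b \<le> 2 ^ j"
  shows "a * (M + 2) ^ d + b \<le> (M + 2) ^ (d + j)"
proof -
  have "a * (M + 2) ^ d + b \<le> a * (M + 2) ^ d + b * (M + 2) ^ d" by simp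
  also have "\<dots> = (a + b) * (M + 2) ^ d" by (simp add: algebra_simps)
  also have "\<dots> \<le> 2 ^ j * (M + 2) ^ d" using assms by (intro mult_right_mono) auto
  also have "\<dots> \<le> (M + 2) ^ j * (M + 2) ^ d" by (intro mult_right_mono power_mono) auto
  finally show ?thesis by (simp add: power_add mult.commute)
qed

lemma ptimeI0:
  assumes "\<And>P M c env. D M c \<Longrightarrow> eval_within P (enc c # env) b (enc (f c)) 2"
  shows "ptime D f"
proof -
  have "realizes m [] D 1 f b" for m
    unfolding realizes_def
  proof (intro allI impI)
    fix Q Q' :: program and M c env assume "D M c"
    then have "eval_within (Q @ [] @ Q') (enc c # env) b (enc (f c)) 2" by (rule assms)
    then show "eval_within (Q @ [] @ Q') (enc c # env) b (enc (f c)) ((M + 2) ^ 1)"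
      by (rule eval_within_mono) simp
  qed
  then show ?thesis unfolding ptime_def by blast
qed

text \<open>The allowance of 7 steps matches \<open>1 + 7 = 2 ^ 3\<close>, that is, three further
  degrees.\<close>

lemma ptimeI1:
  assumes "ptime D f"
    and "\<And>P M c env a B. D M c \<Longrightarrow> eval_within P (enc c # env) a (enc (f c)) B
      \<Longrightarrow> eval_within P (enc c # env) (F a) (enc (h c)) (B + 7)"
  shows "ptime D h"
proof -
  obtain d where d: "\<forall>m. \<exists>R b. realizes m R D d f b" using assms(1) unfolding ptime_def ..
  have "\<exists>R b. realizes m R D (d + 3) h b" for m
  proof -
    obtain R a where R: "realizes m R D d f a" using d by blast
    have "realizes m R D (d + 3) h (F a)"
      unfolding realizes_def
    proof (intro allI impI)
      fix Q Q' :: program and M c env assume "length Q = m" and D: "D M c"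
      from assms(2)[OF D realizesD[OF R this]]
      show "eval_within (Q @ R @ Q') (enc c # env) (F a) (enc (h c)) ((M + 2) ^ (d + 3))"
        by (rule eval_within_mono) (use power_bound_linear[of 1 7 3 M d] in simp)
    qed
    then show ?thesis by blast
  qed
  then show ?thesis unfolding ptime_def by blast
qed

lemma ptimeI2:
  assumes "ptime D f" "ptime D g"
    and "\<And>P M c env a b B. D M c \<Longrightarrow> eval_within P (enc c # env) a (enc (f c)) B
      \<Longrightarrow> eval_within P (enc c # env) b (enc (g c)) B
      \<Longrightarrow> eval_within P (enc c # env) (F a b) (enc (h c)) (B + B + 1)"
  shows "ptime D h"
proof -
  obtain d where d: "\<And>m. \<exists>R a b. realizes m R D d f a \<and> realizes m R D d g b"
    using ptime_joint2[OF assms(1,2)] by blast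
  have "\<exists>R b. realizes m R D (d + 2) h b" for m
  proof -
    obtain R a b where R: "realizes m R D d f a" "realizes m R D d g b" using d by blast
    have "realizes m R D (d + 2) h (F a b)"
      unfolding realizes_def
    proof (intro allI impI)
      fix Q Q' :: program and M c env assume Q: "length Q = m" and D: "D M c"
      from assms(3)[OF D realizesD[OF R(1) Q D] realizesD[OF R(2) Q D]]
      show "eval_within (Q @ R @ Q') (enc c # env) (F a b) (enc (h c)) ((M + 2) ^ (d + 2))"
        by (rule eval_within_mono) (use power_bound_linear[of 2 1 2 M d] in simp)
    qed
    then show ?thesis by blast
  qed
  then show ?thesis unfolding ptime_def by blast
qed

lemma ptime_dom:
  assumes "ptime D' f" "\<And>M c. D M c \<Longrightarrow> D' M c"
  shows "ptime D f"
proof -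
  have "realizes m R D d f b" if "realizes m R D' d f b" for m R d b
    using that assms(2) unfolding realizes_def by simp
  then show ?thesis using assms(1) unfolding ptime_def by metis
qed

lemma ptime_cong:
  assumes "ptime D f" "\<And>M c. D M c \<Longrightarrow> f c = g c"
  shows "ptime D g"
proof -
  have "realizes m R D d g b" if "realizes m R D d f b" for m R d b
    using that assms(2) unfolding realizes_def by simp
  then show ?thesis using assms(1) unfolding ptime_def by metis
qed

section \<open>Closure under elementary operations\<close>

lemma ptime_id: "ptime D (\<lambda>c. c)"
proof (rule ptimeI0[where b = "EVar 0"])
  fix P M c env
  show "eval_within P (enc c # env) (EVar 0) (enc c) 2"
    using eval_within_mono[OF eval_within_Var[of 0 "enc c # env" P], of 2] by simp
qed

lemma ptime_const_nat: "ptime D (\<lambda>c. k :: nat)"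
  by (rule ptimeI0[where b = "ENum k"])
    (simp add: enc_nat_def eval_within_mono[OF eval_within_Num])

lemma ptime_const_bool: "ptime D (\<lambda>c. k :: bool)"
  by (rule ptimeI0[where b = "ENum (if k then 1 else 0)"])
    (simp add: enc_bool_def eval_within_mono[OF eval_within_Num])

lemma ptime_Nil: "ptime D (\<lambda>c. [])"
  by (rule ptimeI0[where b = "ENum 0"])
    (simp add: eval_within_mono[OF eval_within_Num])

lemma ptime_fst: "ptime D f \<Longrightarrow> ptime D (\<lambda>c. fst (f c))"
  by (rule ptimeI1[where F = EFst])
    (auto simp: enc_prod_def intro: eval_within_mono[OF eval_within_Fst])

lemma ptime_snd: "ptime D f \<Longrightarrow> ptime D (\<lambda>c. snd (f c))"
  by (rule ptimeI1[where F = ESnd])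
    (auto simp: enc_prod_def intro: eval_within_mono[OF eval_within_Snd])

lemma ptime_hd:
  assumes "ptime D f" "\<And>M c. D M c \<Longrightarrow> f c \<noteq> []"
  shows "ptime D (\<lambda>c. hd (f c))"
proof (rule ptimeI1[OF assms(1), where F = EFst])
  fix P M c env a B
  assume "D M c" and e: "eval_within P (enc c # env) a (enc (f c)) B"
  then obtain x xs where "f c = x # xs" using assms(2) by (meson list.exhaust)
  then show "eval_within P (enc c # env) (EFst a) (enc (hd (f c))) (B + 7)"
    using e by (auto intro: eval_within_mono[OF eval_within_Fst])
qed

lemma ptime_is_Nil:
  assumes "ptime D f"
  shows "ptime D (\<lambda>c. f c = [])"
proof (rule ptimeI1[OF assms, where F = "\<lambda>a. ELess (EIsPair a) (ENum 1)"])
  fix P M c env a B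
  assume e: "eval_within P (enc c # env) a (enc (f c)) B"
  have "eval_within P (enc c # env) (EIsPair a) (VNum (if f c = [] then 0 else 1)) (B + 1)"
    using e eval_within_IsPair_Num eval_within_IsPair_Pair by (cases "f c") fastforce+
  from eval_within_Less[OF this eval_within_Num, of 1]
  show "eval_within P (enc c # env) (ELess (EIsPair a) (ENum 1)) (enc (f c = [])) (B + 7)"
    by (auto simp: enc_bool_def intro: eval_within_mono split: if_splits)
qed

lemma ptime_Pair:
  assumes "ptime D f" "ptime D g"
  shows "ptime D (\<lambda>c. (f c, g c))"
  by (rule ptimeI2[OF assms, where F = EPair]) (use eval_within_Pair in fastforce)

lemma ptime_Cons:
  assumes "ptime D f" "ptime D g"
  shows "ptime D (\<lambda>c. f c # g c)"
  by (rule ptimeI2[OF assms, where F = EPair]) (use eval_within_Pair in fastforce)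

lemma ptime_add:
  assumes "ptime D f" "ptime D g"
  shows "ptime D (\<lambda>c. f c + g c :: nat)"
  by (rule ptimeI2[OF assms, where F = EAdd]) (use eval_within_Add in \<open>fastforce simp: enc_nat_def\<close>)

lemma ptime_less:
  assumes "ptime D f" "ptime D g"
  shows "ptime D (\<lambda>c. f c < (g c :: nat))"
  by (rule ptimeI2[OF assms, where F = ELess])
    (use eval_within_Less in \<open>fastforce simp: enc_nat_def enc_bool_def\<close>)

text \<open>Each branch has to be computable only where it is taken; this admits \<open>hd\<close>
  in a branch guarded by a test for emptiness.\<close>

lemma ptime_if:
  assumes "ptime D q" "ptime (\<lambda>M c. D M c \<and> q c) f" "ptime (\<lambda>M c. D M c \<and> \<not> q c) g"
  shows "ptime D (\<lambda>c. if q c then f c else g c)"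
proof -
  obtain d where d: "\<And>m. \<exists>R a b e. realizes m R D d q a \<and> realizes m R (\<lambda>M c. D M c \<and> q c) d f b
      \<and> realizes m R (\<lambda>M c. D M c \<and> \<not> q c) d g e"
    using ptime_joint3[OF assms] by blast
  have "\<exists>R b. realizes m R D (d + 2) (\<lambda>c. if q c then f c else g c) b" for m
  proof -
    obtain R a b e where R: "realizes m R D d q a" "realizes m R (\<lambda>M c. D M c \<and> q c) d f b"
        "realizes m R (\<lambda>M c. D M c \<and> \<not> q c) d g e" using d by blast
    have "realizes m R D (d + 2) (\<lambda>c. if q c then f c else g c) (EIf a b e)"
      unfolding realizes_def
    proof (intro allI impI)
      fix Q Q' :: program and M c env assume Q: "length Q = m" and D: "D M c"
      let ?B = "(M + 2) ^ d"
      have "eval_within (Q @ R @ Q') (enc c # env) (EIf a b e) (enc (if q c then f c else g c))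
          (?B + ?B + 1)"
        by (rule eval_within_If[of _ _ _ "q c"])
          (use realizesD[OF R(1) Q D, of Q' env] realizesD[OF R(2) Q, of M c Q' env]
            realizesD[OF R(3) Q, of M c Q' env] D in \<open>auto simp: enc_bool_def\<close>)
      then show "eval_within (Q @ R @ Q') (enc c # env) (EIf a b e)
          (enc (if q c then f c else g c)) ((M + 2) ^ (d + 2))"
        by (rule eval_within_mono) (use power_bound_linear[of 2 1 2 M d] in simp)
    qed
    then show ?thesis by blast
  qed
  then show ?thesis unfolding ptime_def by blast
qed

text \<open>The intermediate value has to meet the domain of \<open>g\<close> for the same
  \<open>M\<close>. So the two time bounds are added rather than composed, and the degree grows by a
  constant.\<close>

lemma ptime_comp:
  assumes "ptime D' g" "ptime D f" "\<And>M c. D M c \<Longrightarrow> D' M (f c)"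
  shows "ptime D (\<lambda>c. g (f c))"
proof -
  obtain d where d: "\<And>m. \<exists>R a b. realizes m R D d f a \<and> realizes m R D' d g b"
    using ptime_joint2[OF assms(2,1)] by blast
  have "\<exists>R b. realizes m R D (d + 2) (\<lambda>c. g (f c)) b" for m
  proof -
    obtain R a b where R: "realizes m R D d f a" "realizes m R D' d g b" using d by blast
    have "realizes m R D (d + 2) (\<lambda>c. g (f c)) (ELet a b)"
      unfolding realizes_def
    proof (intro allI impI)
      fix Q Q' :: program and M c env assume Q: "length Q = m" and D: "D M c"
      from eval_within_Let[OF realizesD[OF R(1) Q D] realizesD[OF R(2) Q assms(3)[OF D]]]
      show "eval_within (Q @ R @ Q') (enc c # env) (ELet a b) (enc (g (f c))) ((M + 2) ^ (d + 2))"
        by (rule eval_within_mono) (use power_bound_linear[of 2 1 2 M d] in simp)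
    qed
    then show ?thesis by blast
  qed
  then show ?thesis unfolding ptime_def by blast
qed

text \<open>Recording \<open>snd p = f (fst p)\<close> in the domain keeps the size facts about the
  bound value available in the body.\<close>

lemma ptime_let:
  assumes "ptime D f" "ptime (\<lambda>M p. D M (fst p) \<and> snd p = f (fst p)) (\<lambda>p. g (fst p) (snd p))"
  shows "ptime D (\<lambda>c. let x = f c in g c x)"
proof -
  have "ptime D (\<lambda>c. (\<lambda>p. g (fst p) (snd p)) (c, f c))"
    by (rule ptime_comp[OF assms(2) ptime_Pair[OF ptime_id assms(1)]]) simp
  then show ?thesis by simp
qed

lemma ptime_not: "ptime D f \<Longrightarrow> ptime D (\<lambda>c. \<not> f c)"
  using ptime_if[OF _ ptime_const_bool[of _ False] ptime_const_bool[of _ True], of D f]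
  by (auto intro: ptime_cong)

lemma ptime_and:
  assumes "ptime D f" "ptime (\<lambda>M c. D M c \<and> f c) g"
  shows "ptime D (\<lambda>c. f c \<and> g c)"
  using ptime_if[OF assms ptime_const_bool[of _ False]]
  by (rule ptime_cong) simp

lemma ptime_or:
  assumes "ptime D f" "ptime (\<lambda>M c. D M c \<and> \<not> f c) g"
  shows "ptime D (\<lambda>c. f c \<or> g c)"
  using ptime_if[OF assms(1) ptime_const_bool[of _ True] assms(2)]
  by (rule ptime_cong) simp

lemma ptime_eq_nat:
  assumes "ptime D f" "ptime D g"
  shows "ptime D (\<lambda>c. f c = (g c :: nat))"
proof (rule ptime_cong)
  show "ptime D (\<lambda>c. \<not> (f c < g c \<or> g c < f c))"
    by (intro ptime_not ptime_or ptime_less assms ptime_dom[OF assms(1), of "\<lambda>M c. D M c \<and> \<not> f c < g c"]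
        ptime_dom[OF assms(2), of "\<lambda>M c. D M c \<and> \<not> f c < g c"]) auto
qed auto

lemma ptime_le_nat:
  assumes "ptime D f" "ptime D g"
  shows "ptime D (\<lambda>c. f c \<le> (g c :: nat))"
  unfolding not_less[symmetric] by (intro ptime_not ptime_less assms)


section \<open>Bounded iteration\<close>

definition pbounded :: "(nat \<Rightarrow> 'c \<Rightarrow> bool) \<Rightarrow> ('c \<Rightarrow> nat) \<Rightarrow> bool" where
  "pbounded D h \<longleftrightarrow> (\<exists>d. \<forall>M c. D M c \<longrightarrow> h c \<le> (M + 2) ^ d)"

lemma pbounded_linear: "(\<And>M c. D M c \<Longrightarrow> h c \<le> M) \<Longrightarrow> pbounded D h"
  unfolding pbounded_def by (rule exI[of _ 1]) force

lemma pbounded_power: "(\<And>M c. D M c \<Longrightarrow> h c \<le> (M + 2) ^ d) \<Longrightarrow> pbounded D h"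
  unfolding pbounded_def by blast

text \<open>The value in variable 0 is the triple of the context, the remaining list, and the accumulator.\<close>

definition fold_loop :: "nat \<Rightarrow> expr \<Rightarrow> expr" where
  "fold_loop i b = EIf (EIsPair (EFst (ESnd (EVar 0))))
     (ECall i (EPair (EFst (EVar 0)) (EPair (ESnd (EFst (ESnd (EVar 0))))
        (ELet (EPair (EFst (EVar 0)) (EPair (EFst (EFst (ESnd (EVar 0)))) (ESnd (ESnd (EVar 0))))) b))))
     (ESnd (ESnd (EVar 0)))"

text \<open>The constants 40 and 10 generously cover the overhead of one round and of the final
  test.\<close>

lemma eval_fold_loop:
  fixes g :: "'c :: encodable \<times> 'x :: encodable \<times> 'a :: encodable \<Rightarrow> 'a"
  assumes i: "i < length P" "P ! i = fold_loop i b"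
    and step: "\<And>x xs a env. I (x # xs) a \<Longrightarrow>
      I xs (g (c, x, a)) \<and> eval_within P (enc (c, x, a) # env) b (enc (g (c, x, a))) B"
    and "I xs a"
  shows "eval_within P [enc (c, xs, a)] (fold_loop i b)
    (enc (foldl (\<lambda>a x. g (c, x, a)) a xs)) (length xs * (B + 40) + 10)"
  using \<open>I xs a\<close>
proof (induction xs arbitrary: a)
  case Nil
  let ?env = "[enc (c, [] :: 'x list, a)]"
  have v: "eval_within P ?env (EVar 0) (VPair (enc c) (VPair (VNum 0) (enc a))) 1"
    using eval_within_Var[of 0 ?env P] by simp
  note p = eval_within_IsPair_Num[OF eval_within_Fst[OF eval_within_Snd[OF v]]]
  have "eval_within P ?env (fold_loop i b) (enc a) (1 + 1 + 1 + 1 + (1 + 1 + 1) + 1)"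
    unfolding fold_loop_def
    by (rule eval_within_If[where q = False]) (use p eval_within_Snd[OF eval_within_Snd[OF v]] in simp_all)
  then show ?case by (auto intro: eval_within_mono)
next
  case (Cons x xs)
  let ?env = "[enc (c, x # xs, a)]"
  let ?a = "g (c, x, a)"
  have v: "eval_within P ?env (EVar 0) (VPair (enc c) (VPair (VPair (enc x) (enc xs)) (enc a))) 1"
    using eval_within_Var[of 0 ?env P] by simp
  note c = eval_within_Fst[OF v] and l = eval_within_Fst[OF eval_within_Snd[OF v]]
    and a = eval_within_Snd[OF eval_within_Snd[OF v]]
  have st: "I xs ?a" "eval_within P (enc (c, x, a) # ?env) b (enc ?a) B"
    using step[OF Cons.prems] by auto
  have "eval_within P (VPair (enc c) (VPair (enc x) (enc a)) # ?env) b (enc ?a) B"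
    using st(2) by simp
  note s = eval_within_Let[OF eval_within_Pair[OF c eval_within_Pair[OF eval_within_Fst[OF l] a]] this]
  note arg = eval_within_Pair[OF c eval_within_Pair[OF eval_within_Snd[OF l] s]]
  let ?r = "enc (foldl (\<lambda>a x. g (c, x, a)) ?a xs)"
  have "eval_within P [enc (c, xs, ?a)] (fold_loop i b) ?r (length xs * (B + 40) + 10)"
    by (rule Cons.IH[OF st(1)])
  then have "eval_within P [VPair (enc c) (VPair (enc xs) (enc ?a))] (P ! i) ?r
      (length xs * (B + 40) + 10)"
    using i by simp
  note call = eval_within_Call[OF arg i(1) this]
  note t = eval_within_IsPair_Pair[OF l]
  have "eval_within P ?env (fold_loop i b) ?r
     (1 + 1 + 1 + 1 + (1 + 1 + (1 + 1 + 1 + 1 + (1 + 1 + (1 + 1 + 1 + 1 + (1 + 1 + 1) + 1) + 1 + B + 1)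
       + 1) + 1 + (length xs * (B + 40) + 10) + 1) + 1)"
    unfolding fold_loop_def
    by (rule eval_within_If[where q = True]) (use t call[unfolded fold_loop_def] in simp_all)
  then have "eval_within P ?env (fold_loop i b) ?r (length (x # xs) * (B + 40) + 10)"
    by (rule eval_within_mono) simp
  then show ?case by simp
qed

text \<open>Iterating a polynomial-time step need not take polynomial time, as the accumulator could
  grow in every round. The invariant \<open>I\<close> keeps each intermediate argument in the domain
  \<open>D'\<close> for the same \<open>M\<close>, so that every step of the fold costs at most
  \<open>(M + 2) ^ d\<close>. It may refer to the remaining list, hence to the number of rounds
  left.\<close>

lemma ptime_foldl_remaining:
  fixes g :: "'c :: encodable \<times> 'x :: encodable \<times> 'a :: encodable \<Rightarrow> 'a"
  assumes "ptime D xs" "ptime D a0" "ptime D' g" and len: "pbounded D (\<lambda>c. length (xs c))"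
    and inv0: "\<And>M c. D M c \<Longrightarrow> I M c (xs c) (a0 c)"
    and inv: "\<And>M c x ys a. D M c \<Longrightarrow> I M c (x # ys) a \<Longrightarrow> D' M (c, x, a) \<and> I M c ys (g (c, x, a))"
  shows "ptime D (\<lambda>c. foldl (\<lambda>a x. g (c, x, a)) (a0 c) (xs c))"
proof -
  let ?h = "\<lambda>c. foldl (\<lambda>a x. g (c, x, a)) (a0 c) (xs c)"
  obtain d where d: "\<And>m. \<exists>R a b e. realizes m R D d xs a \<and> realizes m R D d a0 b \<and> realizes m R D' d g e"
    using ptime_joint3[OF assms(1-3)] by blast
  obtain l where l: "\<And>M c. D M c \<Longrightarrow> length (xs c) \<le> (M + 2) ^ l"
    using len unfolding pbounded_def by blast
  have "\<exists>R b. realizes m R D (l + d + 8) ?h b" for m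
  proof -
    obtain R a b e where R: "realizes m R D d xs a" "realizes m R D d a0 b" "realizes m R D' d g e"
      using d by blast
    let ?i = "m + length R"
    let ?R = "R @ [fold_loop ?i e]"
    \<comment> \<open>Once the list is bound, the context has moved to variable 1;
      \<open>ELet (EVar 1) b\<close> brings it back to variable 0, where \<open>b\<close> expects
      it.\<close>
    let ?b = "ELet a (ELet (EPair (EVar 1) (EPair (EVar 0) (ELet (EVar 1) b))) (ECall ?i (EVar 0)))"
    have "realizes m ?R D (l + d + 8) ?h ?b"
      unfolding realizes_def
    proof (intro allI impI)
      fix Q Q' :: program and M c env assume Q: "length Q = m" and D: "D M c"
      let ?P = "Q @ ?R @ Q'"
      let ?B = "(M + 2) ^ d"
      have i: "?i < length ?P" "?P ! ?i = fold_loop ?i e"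
        using Q by (simp_all add: nth_append)
      have R': "realizes m ?R D d xs a" "realizes m ?R D d a0 b" "realizes m ?R D' d g e"
        using R by (auto intro: realizes_append)
      note xs = realizesD[OF R'(1) Q D, of Q' env]
      let ?env1 = "enc (xs c) # enc c # env"
      have "eval_within ?P ?env1 (EVar 1) (enc c) 1" "eval_within ?P ?env1 (EVar 0) (enc (xs c)) 1"
        using eval_within_Var[of 1 ?env1] eval_within_Var[of 0 ?env1] by auto
      note v = this
      note arg = eval_within_Pair[OF v(1) eval_within_Pair[OF v(2)
            eval_within_Let[OF v(1) realizesD[OF R'(2) Q D, of Q']]]]
      have loop: "eval_within ?P [enc (c, xs c, a0 c)] (?P ! ?i) (enc (?h c))
          (length (xs c) * (?B + 40) + 10)"
        unfolding i(2)
        by (rule eval_fold_loop[OF i, where I = "I M c"])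
          (use inv[OF D] inv0[OF D] realizesD[OF R'(3) Q, of M _ Q'] in auto)
      let ?env2 = "enc (c, xs c, a0 c) # ?env1"
      have "eval_within ?P ?env2 (EVar 0) (enc (c, xs c, a0 c)) 1"
        using eval_within_Var[of 0 ?env2] by auto
      note eval_within_Let[OF xs eval_within_Let[OF arg
            eval_within_Call[OF this[unfolded enc_Pair] i(1) loop[unfolded enc_Pair]]]]
      then show "eval_within ?P (enc c # env) ?b (enc (?h c)) ((M + 2) ^ (l + d + 8))"
      proof (rule eval_within_mono)
        let ?L = "(M + 2) ^ l"
        have arith: "B + (1 + (1 + (1 + B + 1) + 1) + 1 + (1 + (n * (B + 40) + 10) + 1) + 1) + 1
            \<le> 80 * (L * B)" if "n \<le> L" "1 \<le> B" "1 \<le> L" for n B L :: nat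
        proof -
          have "n * (B + 40) \<le> L * (B + 40)" using that(1) by (rule mult_right_mono) simp
          moreover have "L * (B + 40) = L * B + 40 * L" by (simp add: algebra_simps)
          moreover have "B \<le> L * B" "L \<le> L * B" using that by simp_all
          ultimately show ?thesis using that(2) by linarith
        qed
        have "?B + (1 + (1 + (1 + ?B + 1) + 1) + 1 + (1 + (length (xs c) * (?B + 40) + 10) + 1) + 1)
            + 1 \<le> 80 * (?L * ?B)"
          by (rule arith[OF l[OF D]]) simp_all
        also have "\<dots> = 80 * (M + 2) ^ (l + d)" by (simp add: power_add)
        \<comment> \<open>The eight further degrees absorb the factor, as
          \<open>80 \<le> 2 ^ 8\<close>.\<close>
        also have "\<dots> \<le> (M + 2) ^ (l + d + 8)"
          using power_bound_linear[of 80 0 8 M "l + d"] by simp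
        finally show "?B + (1 + (1 + (1 + ?B + 1) + 1) + 1 + (1 + (length (xs c) * (?B + 40) + 10) + 1) + 1)
            + 1 \<le> (M + 2) ^ (l + d + 8)" .
      qed
    qed
    then show ?thesis by blast
  qed
  then show ?thesis unfolding ptime_def by blast
qed

lemma ptime_foldl:
  fixes g :: "'c :: encodable \<times> 'x :: encodable \<times> 'a :: encodable \<Rightarrow> 'a"
  assumes "ptime D xs" "ptime D a0" "ptime D' g" "pbounded D (\<lambda>c. length (xs c))"
    and inv0: "\<And>M c. D M c \<Longrightarrow> I M c (a0 c)"
    and inv: "\<And>M c x a. D M c \<Longrightarrow> x \<in> set (xs c) \<Longrightarrow> I M c a \<Longrightarrow> D' M (c, x, a) \<and> I M c (g (c, x, a))"
  shows "ptime D (\<lambda>c. foldl (\<lambda>a x. g (c, x, a)) (a0 c) (xs c))"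
  by (rule ptime_foldl_remaining[OF assms(1-4), where I = "\<lambda>M c ys a. set ys \<subseteq> set (xs c) \<and> I M c a"])
    (use inv0 inv in auto)

text \<open>Counting down while consing yields the ascending list without a reversal.\<close>

definition upt_loop :: "nat \<Rightarrow> expr" where
  "upt_loop i = EIf (ELess (ENum 0) (EFst (EVar 0)))
     (ECall i (EPair (ESub (EFst (EVar 0)) (ENum 1))
        (EPair (ESub (EFst (EVar 0)) (ENum 1)) (ESnd (EVar 0)))))
     (ESnd (EVar 0))"

lemma eval_upt_loop:
  assumes i: "i < length P" "P ! i = upt_loop i"
  shows "eval_within P [enc (n, xs)] (upt_loop i) (enc ([0..<n] @ xs)) (n * 40 + 10)"
proof (induction n arbitrary: xs)
  case 0
  let ?env = "[enc (0 :: nat, xs)]"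
  have v: "eval_within P ?env (EVar 0) (VPair (VNum 0) (enc xs)) 1"
    using eval_within_Var[of 0 ?env P] by (simp add: enc_nat_def)
  note t = eval_within_Less[OF eval_within_Num[of _ _ 0] eval_within_Fst[OF v]]
  have "eval_within P ?env (upt_loop i) (enc xs) (1 + (1 + 1) + 1 + (1 + 1) + 1)"
    unfolding upt_loop_def
    by (rule eval_within_If[where q = False]) (use t eval_within_Snd[OF v] in simp_all)
  then show ?case by (auto intro: eval_within_mono)
next
  case (Suc n)
  let ?env = "[enc (Suc n, xs)]"
  have v: "eval_within P ?env (EVar 0) (VPair (VNum (Suc n)) (enc xs)) 1"
    using eval_within_Var[of 0 ?env P] by (simp add: enc_nat_def)
  note t = eval_within_Less[OF eval_within_Num[of _ _ 0] eval_within_Fst[OF v]]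
  have "eval_within P ?env (ESub (EFst (EVar 0)) (ENum 1)) (VNum n) (1 + 1 + 1 + 1)"
    using eval_within_Sub[OF eval_within_Fst[OF v] eval_within_Num[of _ _ 1]] by simp
  note s = this
  note arg = eval_within_Pair[OF s eval_within_Pair[OF s eval_within_Snd[OF v]]]
  let ?r = "enc ([0..<Suc n] @ xs)"
  have "eval_within P [VPair (VNum n) (VPair (VNum n) (enc xs))] (P ! i) ?r (n * 40 + 10)"
    using Suc.IH[of "n # xs"] i by (simp add: enc_nat_def)
  note call = eval_within_Call[OF arg i(1) this]
  have "eval_within P ?env (upt_loop i) ?r
     (1 + (1 + 1) + 1 + (1 + 1 + 1 + 1 + (1 + 1 + 1 + 1 + (1 + 1) + 1) + 1 + (n * 40 + 10) + 1) + 1)"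
    unfolding upt_loop_def
    by (rule eval_within_If[where q = True]) (use t call[unfolded upt_loop_def] in simp_all)
  then show ?case by (rule eval_within_mono) simp
qed

lemma ptime_upt_arg: "pbounded D (\<lambda>n. n) \<Longrightarrow> ptime D (\<lambda>n. [0..<n])"
proof -
  assume "pbounded D (\<lambda>n. n)"
  then obtain l where l: "\<And>M n. D M n \<Longrightarrow> n \<le> (M + 2) ^ l"
    unfolding pbounded_def by blast
  have "realizes m [upt_loop m] D (l + 6) (\<lambda>n. [0..<n]) (ECall m (EPair (EVar 0) (ENum 0)))" for m
    unfolding realizes_def
  proof (intro allI impI)
    fix Q Q' :: program and M n env assume Q: "length Q = m" and D: "D M n"
    let ?P = "Q @ [upt_loop m] @ Q'"
    have i: "m < length ?P" "?P ! m = upt_loop m" using Q by (simp_all add: nth_append)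
    have "eval_within ?P (enc n # env) (EPair (EVar 0) (ENum 0)) (VPair (enc n) (VNum 0)) (1 + 1 + 1)"
      using eval_within_Pair[OF eval_within_Var[of 0 "enc n # env"] eval_within_Num] by simp
    moreover have "eval_within ?P [VPair (enc n) (VNum 0)] (?P ! m) (enc [0..<n]) (n * 40 + 10)"
      using eval_upt_loop[OF i, of n "[]"] i by simp
    ultimately have "eval_within ?P (enc n # env) (ECall m (EPair (EVar 0) (ENum 0))) (enc [0..<n])
        (1 + 1 + 1 + (n * 40 + 10) + 1)"
      by (rule eval_within_Call[OF _ i(1)])
    then show "eval_within ?P (enc n # env) (ECall m (EPair (EVar 0) (ENum 0))) (enc [0..<n])
        ((M + 2) ^ (l + 6))"
      by (rule eval_within_mono) (use power_bound_linear[of 40 14 6 M l] l[OF D] in simp)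
  qed
  then show ?thesis unfolding ptime_def by blast
qed

lemma ptime_upt:
  assumes "ptime D f" "pbounded D f"
  shows "ptime D (\<lambda>c. [0..<f c])"
proof -
  obtain l where l: "\<And>M c. D M c \<Longrightarrow> f c \<le> (M + 2) ^ l"
    using assms(2) unfolding pbounded_def by blast
  have "ptime (\<lambda>M n. n \<le> (M + 2) ^ l) (\<lambda>n. [0..<n])"
    by (rule ptime_upt_arg, rule pbounded_power)
  then show ?thesis by (rule ptime_comp[OF _ assms(1)]) (rule l)
qed


section \<open>List functions as folds\<close>

lemma ptime_step_args:
  "ptime D (\<lambda>p. fst (snd p))" "ptime D (\<lambda>p. snd (snd p))" "ptime D (\<lambda>p. (fst p, fst (snd p)))"
  by (intro ptime_fst ptime_snd ptime_id ptime_Pair)+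

lemma ptime_rev:
  assumes "ptime D xs" "pbounded D (\<lambda>c. length (xs c))"
  shows "ptime D (\<lambda>c. rev (xs c))"
proof (rule ptime_cong)
  show "ptime D (\<lambda>c. foldl (\<lambda>a x. (\<lambda>p. fst (snd p) # snd (snd p)) (c, x, a)) [] (xs c))"
    by (rule ptime_foldl[OF assms(1) ptime_Nil ptime_Cons[OF ptime_step_args(1,2)] assms(2),
          where D' = "\<lambda>_ _. True" and I = "\<lambda>_ _ _. True"]) auto
  show "foldl (\<lambda>a x. (\<lambda>p. fst (snd p) # snd (snd p)) (c, x, a)) [] (xs c) = rev (xs c)" for c
    by (simp add: foldl_conv_fold fold_Cons_rev)
qed

lemma ptime_map:
  assumes "ptime D xs" "pbounded D (\<lambda>c. length (xs c))"
    and f: "ptime (\<lambda>M p. D M (fst p) \<and> snd p \<in> set (xs (fst p))) (\<lambda>p. f (fst p) (snd p))"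
  shows "ptime D (\<lambda>c. map (f c) (xs c))"
proof (rule ptime_cong)
  let ?g = "\<lambda>p. f (fst p) (fst (snd p)) # snd (snd p)"
  let ?D = "\<lambda>M p. D M (fst p) \<and> fst (snd p) \<in> set (xs (fst p))"
  have "ptime ?D (\<lambda>p. (\<lambda>q. f (fst q) (snd q)) (fst p, fst (snd p)))"
    by (rule ptime_comp[OF f ptime_step_args(3)]) simp
  then have g: "ptime ?D ?g" by (intro ptime_Cons ptime_step_args) simp
  show "ptime D (\<lambda>c. rev (foldl (\<lambda>a x. ?g (c, x, a)) [] (xs c)))"
  proof (rule ptime_rev)
    show "ptime D (\<lambda>c. foldl (\<lambda>a x. ?g (c, x, a)) [] (xs c))"
      by (rule ptime_foldl[OF assms(1) ptime_Nil g assms(2), where I = "\<lambda>_ _ _. True"]) auto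
    have "length (foldl (\<lambda>a x. f c x # a) ys xs) = length ys + length xs" for c ys and xs :: "'b list"
      by (induction xs arbitrary: ys) auto
    then show "pbounded D (\<lambda>c. length (foldl (\<lambda>a x. ?g (c, x, a)) [] (xs c)))"
      using assms(2) by simp
  qed
  have "rev (foldl (\<lambda>a x. f c x # a) ys xs) = rev ys @ map (f c) xs" for c ys and xs :: "'b list"
    by (induction xs arbitrary: ys) auto
  then show "rev (foldl (\<lambda>a x. ?g (c, x, a)) [] (xs c)) = map (f c) (xs c)" for c by simp
qed

lemma ptime_filter:
  assumes "ptime D xs" "pbounded D (\<lambda>c. length (xs c))"
    and f: "ptime (\<lambda>M p. D M (fst p) \<and> snd p \<in> set (xs (fst p))) (\<lambda>p. q (fst p) (snd p))"
  shows "ptime D (\<lambda>c. filter (q c) (xs c))"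
proof (rule ptime_cong)
  let ?g = "\<lambda>p. if q (fst p) (fst (snd p)) then fst (snd p) # snd (snd p) else snd (snd p)"
  let ?D = "\<lambda>M p. D M (fst p) \<and> fst (snd p) \<in> set (xs (fst p))"
  have "ptime ?D (\<lambda>p. (\<lambda>r. q (fst r) (snd r)) (fst p, fst (snd p)))"
    by (rule ptime_comp[OF f ptime_step_args(3)]) simp
  then have g: "ptime ?D ?g" by (intro ptime_if ptime_Cons ptime_step_args) simp
  have len: "length (foldl (\<lambda>a x. if q c x then x # a else a) ys xs) \<le> length ys + length xs"
    for c ys and xs :: "'b list"
  proof (induction xs arbitrary: ys)
    case (Cons x xs)
    show ?case using Cons.IH[of "x # ys"] Cons.IH[of ys] by auto
  qed simp
  show "ptime D (\<lambda>c. rev (foldl (\<lambda>a x. ?g (c, x, a)) [] (xs c)))"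
  proof (rule ptime_rev)
    show "ptime D (\<lambda>c. foldl (\<lambda>a x. ?g (c, x, a)) [] (xs c))"
      by (rule ptime_foldl[OF assms(1) ptime_Nil g assms(2), where I = "\<lambda>_ _ _. True"]) auto
    obtain d where d: "\<And>M c. D M c \<Longrightarrow> length (xs c) \<le> (M + 2) ^ d"
      using assms(2) unfolding pbounded_def by blast
    show "pbounded D (\<lambda>c. length (foldl (\<lambda>a x. ?g (c, x, a)) [] (xs c)))"
    proof (rule pbounded_power)
      fix M c assume "D M c"
      from len[of c "[]" "xs c"] d[OF this]
      show "length (foldl (\<lambda>a x. ?g (c, x, a)) [] (xs c)) \<le> (M + 2) ^ d"
        by (simp cong: if_cong)
    qed
  qed
  have "rev (foldl (\<lambda>a x. if q c x then x # a else a) ys xs) = rev ys @ filter (q c) xs"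
    for c ys and xs :: "'b list"
    by (induction xs arbitrary: ys) auto
  then show "rev (foldl (\<lambda>a x. ?g (c, x, a)) [] (xs c)) = filter (q c) (xs c)" for c by (simp cong: if_cong)
qed

lemma ptime_bex:
  assumes "ptime D xs" "pbounded D (\<lambda>c. length (xs c))"
    and f: "ptime (\<lambda>M p. D M (fst p) \<and> snd p \<in> set (xs (fst p))) (\<lambda>p. q (fst p) (snd p))"
  shows "ptime D (\<lambda>c. \<exists>x\<in>set (xs c). q c x)"
proof (rule ptime_cong)
  show "ptime D (\<lambda>c. \<not> filter (q c) (xs c) = [])"
    by (rule ptime_not[OF ptime_is_Nil[OF ptime_filter[OF assms]]])
qed (auto simp: filter_empty_conv)

lemma ptime_ball:
  assumes "ptime D xs" "pbounded D (\<lambda>c. length (xs c))"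
    and f: "ptime (\<lambda>M p. D M (fst p) \<and> snd p \<in> set (xs (fst p))) (\<lambda>p. q (fst p) (snd p))"
  shows "ptime D (\<lambda>c. \<forall>x\<in>set (xs c). q c x)"
proof (rule ptime_cong)
  show "ptime D (\<lambda>c. \<not> (\<exists>x\<in>set (xs c). \<not> q c x))"
    by (rule ptime_not[OF ptime_bex[OF assms(1,2) ptime_not[OF f]]])
qed auto

lemma ptime_sum_list:
  assumes "ptime D xs" "pbounded D (\<lambda>c. length (xs c))"
  shows "ptime D (\<lambda>c. sum_list (xs c) :: nat)"
proof (rule ptime_cong)
  show "ptime D (\<lambda>c. foldl (\<lambda>a x. (\<lambda>p. fst (snd p) + snd (snd p)) (c, x, a)) 0 (xs c))"
    by (rule ptime_foldl[OF assms(1) ptime_const_nat ptime_add[OF ptime_step_args(1,2)] assms(2),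
          where D' = "\<lambda>_ _. True" and I = "\<lambda>_ _ _. True"]) auto
  have "foldl (\<lambda>a x. x + a) b xs = b + sum_list xs" for b :: nat and xs
    by (induction xs arbitrary: b) auto
  then show "foldl (\<lambda>a x. (\<lambda>p. fst (snd p) + snd (snd p)) (c, x, a)) 0 (xs c) = sum_list (xs c)" for c
    by simp
qed

lemma ptime_length:
  assumes "ptime D xs" "pbounded D (\<lambda>c. length (xs c))"
  shows "ptime D (\<lambda>c. length (xs c))"
proof (rule ptime_cong)
  show "ptime D (\<lambda>c. sum_list (map (\<lambda>x. 1 :: nat) (xs c)))"
    by (rule ptime_sum_list[OF ptime_map[OF assms, of "\<lambda>_ _. 1", OF ptime_const_nat]]) (use assms(2) in simp)
qed (simp add: sum_list_triv)

lemma length_concat_le: "(\<And>xs. xs \<in> set xss \<Longrightarrow> length xs \<le> b) \<Longrightarrow> length (concat xss) \<le> length xss * b"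
  by (induction xss) (auto intro: add_mono)

text \<open>The total length is at most the product of the outer and the inner bound. The inner one
  carries an explicit exponent \<open>e\<close> because it has to be uniform over all member
  lists.\<close>

lemma ptime_concat:
  assumes "ptime D xss" "pbounded D (\<lambda>c. length (xss c))"
    and len: "\<And>M c xs. D M c \<Longrightarrow> xs \<in> set (xss c) \<Longrightarrow> length xs \<le> (M + 2) ^ e"
  shows "ptime D (\<lambda>c. concat (xss c))"
proof (rule ptime_cong)
  let ?g = "\<lambda>p. foldl (\<lambda>a x. (\<lambda>p. fst (snd p) # snd (snd p)) (p, x, a)) (snd (snd p)) (fst (snd p))"
  let ?D = "\<lambda>M p. D M (fst p) \<and> fst (snd p) \<in> set (xss (fst p))"
  have g: "ptime ?D ?g"
    by (rule ptime_foldl[OF ptime_step_args(1,2) ptime_Cons[OF ptime_step_args(1,2)],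
          where D' = "\<lambda>_ _. True" and I = "\<lambda>_ _ _. True"])
      (auto intro!: pbounded_power len)
  have g_eq: "?g (c, x, a) = rev x @ a" for c x a
    by (simp add: foldl_conv_fold fold_Cons_rev)
  have cat: "foldl (\<lambda>a x. rev x @ a) ys xs = rev (concat xs) @ ys" for ys :: "'b list" and xs
    by (induction xs arbitrary: ys) auto
  show "ptime D (\<lambda>c. rev (foldl (\<lambda>a x. ?g (c, x, a)) [] (xss c)))"
  proof (rule ptime_rev)
    show "ptime D (\<lambda>c. foldl (\<lambda>a x. ?g (c, x, a)) [] (xss c))"
      by (rule ptime_foldl[OF assms(1) ptime_Nil g assms(2), where I = "\<lambda>_ _ _. True"]) auto
    obtain d where d: "\<And>M c. D M c \<Longrightarrow> length (xss c) \<le> (M + 2) ^ d"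
      using assms(2) unfolding pbounded_def by blast
    have "length (concat (xss c)) \<le> (M + 2) ^ (d + e)" if "D M c" for M c
    proof -
      have "length (concat (xss c)) \<le> length (xss c) * (M + 2) ^ e"
        by (rule length_concat_le) (rule len[OF that])
      also have "\<dots> \<le> (M + 2) ^ d * (M + 2) ^ e" using d[OF that] by (rule mult_right_mono) simp
      finally show ?thesis by (simp add: power_add)
    qed
    then show "pbounded D (\<lambda>c. length (foldl (\<lambda>a x. ?g (c, x, a)) [] (xss c)))"
      unfolding g_eq cat by (intro pbounded_power) simp
  qed
  show "rev (foldl (\<lambda>a x. ?g (c, x, a)) [] (xss c)) = concat (xss c)" for c
    unfolding g_eq cat by simp
qed

section \<open>The algorithm\<close>

definition adjacent :: "(nat \<times> nat) list \<Rightarrow> nat \<Rightarrow> nat \<Rightarrow> bool" where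
  "adjacent es u v \<longleftrightarrow> (\<exists>e\<in>set es. (fst e = u \<and> snd e = v) \<or> (fst e = v \<and> snd e = u))"

text \<open>Filtering \<open>A\<close>, instead of adding vertices to \<open>X\<close>, keeps the
  result no longer than \<open>A\<close> and distinct whenever \<open>A\<close> is.\<close>

definition grow :: "(nat \<times> nat) list \<Rightarrow> nat list \<Rightarrow> nat list \<Rightarrow> nat list" where
  "grow es A X = filter (\<lambda>u. \<exists>w\<in>set X. w = u \<or> adjacent es w u) A"

text \<open>The list that is folded over serves only as a counter: a simple path within
  \<open>A\<close> has at most \<open>length A\<close> vertices, so that many rounds
  suffice.\<close>

definition component_of :: "(nat \<times> nat) list \<Rightarrow> nat list \<Rightarrow> nat \<Rightarrow> nat list" where
  "component_of es A v = foldl (\<lambda>X _. grow es A X) (filter (\<lambda>u. u = v) A) A"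

text \<open>The least vertex stands for its component, so no component of a distinct list is treated
  twice.\<close>

definition reps :: "(nat \<times> nat) list \<Rightarrow> nat list \<Rightarrow> nat list" where
  "reps es A = filter (\<lambda>v. \<forall>w\<in>set (component_of es A v). v \<le> w) A"

text \<open>Deleting the number \<open>n\<close>, which is not a vertex, covers separators with fewer than \<open>k\<close> vertices.\<close>

definition complements :: "nat \<Rightarrow> nat \<Rightarrow> nat list list" where
  "complements n k = foldl (\<lambda>As _. concat (map (\<lambda>A. map (\<lambda>s. filter (\<lambda>x. x \<noteq> s) A) [0..<n + 1]) As))
     [[0..<n]] [0..<k]"

text \<open>A component arises from many deleted sets and from each of its vertices. Such duplicates
  are covered by the size bounds, and \<open>lookup\<close> compares pieces by their
  elements.\<close>

definition pieces :: "nat \<Rightarrow> (nat \<times> nat) list \<Rightarrow> nat \<Rightarrow> nat list list" where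
  "pieces n es k = concat (map (\<lambda>A. map (\<lambda>v. component_of es A v) A) (complements n k))"

text \<open>
  A solution for a piece lists the pairs \<open>(r, D)\<close> of a subpiece \<open>D\<close> and its root \<open>r\<close>, which becomes
  a hub of all vertices of \<open>D\<close>.
\<close>

type_synonym solution = "(nat \<times> nat list) list"

text \<open>Hub assignments are counted with multiplicity, which makes this an upper bound on the
  size of the labeling even if a root repeats.\<close>

definition cost :: "solution \<Rightarrow> nat" where
  "cost s = sum_list (map (\<lambda>p. length (snd p)) s)"

definition same_elems :: "nat list \<Rightarrow> nat list \<Rightarrow> bool" where
  "same_elems C D \<longleftrightarrow> (\<forall>x\<in>set C. \<exists>y\<in>set D. x = y) \<and> (\<forall>y\<in>set D. \<exists>x\<in>set C. x = y)"

definition cheapest :: "solution list \<Rightarrow> solution list" where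
  "cheapest ss = filter (\<lambda>s. \<forall>t\<in>set ss. cost s \<le> cost t) ss"

text \<open>The empty list means that there is no entry.\<close>

definition lookup :: "(nat list \<times> solution) list \<Rightarrow> nat list \<Rightarrow> solution list" where
  "lookup tab C = (let ss = cheapest (map snd (filter (\<lambda>e. same_elems (fst e) C) tab))
     in if ss = [] then [] else [hd ss])"

text \<open>The inner \<open>concat\<close> strips the singleton lists returned by
  \<open>lookup\<close>, the outer one joins the solutions. A missing entry means that a subpiece is
  not enumerated or not yet solved; the root \<open>r\<close> is then skipped in this round.\<close>

definition extend :: "(nat \<times> nat) list \<Rightarrow> (nat list \<times> solution) list \<Rightarrow> nat list \<Rightarrow> nat \<Rightarrow> solution list" where
  "extend es tab C r = (let A = filter (\<lambda>x. x \<noteq> r) C;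
     ss = map (\<lambda>v. lookup tab (component_of es A v)) (reps es A)
     in if \<exists>s\<in>set ss. s = [] then [] else [(r, C) # concat (concat ss)])"

text \<open>The table is recomputed from the previous one instead of being extended, so its length
  does not accumulate over the rounds.\<close>

definition improve :: "(nat \<times> nat) list \<Rightarrow> nat list list \<Rightarrow> (nat list \<times> solution) list \<Rightarrow>
    (nat list \<times> solution) list" where
  "improve es Cs tab = concat (map (\<lambda>C. concat (map (\<lambda>r. map (\<lambda>s. (C, s)) (extend es tab C r)) C)) Cs)"

text \<open>A piece has at most \<open>n\<close> vertices and its subpieces are smaller, so after
  \<open>n\<close> rounds the whole tree is covered.\<close>

definition table :: "nat \<Rightarrow> (nat \<times> nat) list \<Rightarrow> nat list list \<Rightarrow> (nat list \<times> solution) list" where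
  "table n es Cs = foldl (\<lambda>tab _. improve es Cs tab) [] [0..<n]"

definition labels :: "nat \<Rightarrow> solution \<Rightarrow> nat list list" where
  "labels n s = map (\<lambda>u. map fst (filter (\<lambda>p. \<exists>x\<in>set (snd p). x = u) s)) [0..<n]"

text \<open>The test keeps \<open>hd\<close> away from the empty list, as \<open>ptime_hd\<close>
  demands.\<close>

definition hub_algorithm :: "nat \<Rightarrow> nat \<Rightarrow> (nat \<times> nat) list \<Rightarrow> nat list list" where
  "hub_algorithm k n es = (let ss = lookup (table n es (pieces n es k)) [0..<n]
     in labels n (if ss = [] then [] else hd ss))"

section \<open>Computation of components\<close>

lemma foldl_const: "foldl (\<lambda>a _. f a) a xs = (f ^^ length xs) a"
  by (induction xs arbitrary: a) (simp_all add: funpow_swap1)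

lemma adjacent_iff: "adjacent es u v \<longleftrightarrow> {u, v} \<in> edge_set es"
  by (force simp: adjacent_def edge_set_def doubleton_eq_iff image_iff split: prod.splits)

lemma set_grow: "set (grow es A X) = {u \<in> set A. \<exists>w\<in>set X. w = u \<or> {w, u} \<in> edge_set es}"
  by (auto simp: grow_def adjacent_iff)

lemma component_of_eq: "component_of es A v = ((grow es A) ^^ length A) (filter (\<lambda>u. u = v) A)"
  unfolding component_of_def by (rule foldl_const)

lemma grow_iterate_sound:
  assumes "v \<in> set A"
  shows "w \<in> set (((grow es A) ^^ i) (filter (\<lambda>u. u = v) A)) \<Longrightarrow> reach (set A) (edge_set es) v w"
proof (induction i arbitrary: w)
  case 0
  then have "w = v" by simp
  then show ?case using reach_refl[OF assms] by simp
next
  case (Suc i)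
  then obtain x where w: "w \<in> set A"
    and x: "x \<in> set (((grow es A) ^^ i) (filter (\<lambda>u. u = v) A))" "x = w \<or> {x, w} \<in> edge_set es"
    by (auto simp: set_grow)
  from x(2) show ?case
  proof
    assume "x = w"
    then show ?thesis using Suc.IH x(1) by simp
  next
    assume "{x, w} \<in> edge_set es"
    then show ?thesis by (rule reach_step[OF Suc.IH[OF x(1)] _ w])
  qed
qed

text \<open>Each round of \<open>grow\<close> follows the path one vertex further. A path with a
  single vertex is covered before any round, hence \<open>Suc i\<close>.\<close>

lemma grow_iterate_complete:
  "path_between (set A) (edge_set es) v w p \<Longrightarrow> length p \<le> Suc i \<Longrightarrow>
    w \<in> set (((grow es A) ^^ i) (filter (\<lambda>u. u = v) A))"
proof (induction p arbitrary: i w rule: rev_induct)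
  case Nil
  then show ?case by (simp add: path_between_def is_path_def)
next
  case (snoc x xs)
  have w: "w = x" "w \<in> set A" using snoc.prems(1) by (auto simp: path_between_def is_path_def)
  show ?case
  proof (cases "xs = []")
    case True
    then have v: "w = v" using snoc.prems(1) by (auto simp: path_between_def is_path_def)
    have "w \<in> set (((grow es A) ^^ j) (filter (\<lambda>u. u = v) A))" for j
    proof (induction j)
      case 0
      show ?case using w v by simp
    next
      case (Suc j)
      then show ?case using w(2) by (auto simp: set_grow)
    qed
    then show ?thesis .
  next
    case False
    then obtain i' where i: "i = Suc i'" using snoc.prems(2) by (cases i) auto
    have "path_between (set A) (edge_set es) v (last xs) xs" and e: "{last xs, w} \<in> edge_set es"
      using snoc.prems(1) False by (auto simp: path_between_def is_path_def successively_append_iff)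
    then have "last xs \<in> set (((grow es A) ^^ i') (filter (\<lambda>u. u = v) A))"
      using snoc.IH snoc.prems(2) i by simp
    then show ?thesis using e w(2) i by (auto simp: set_grow)
  qed
qed

lemma set_component_of:
  assumes "v \<in> set A"
  shows "set (component_of es A v) = {w. reach (set A) (edge_set es) v w}"
proof
  show "set (component_of es A v) \<subseteq> {w. reach (set A) (edge_set es) v w}"
    using grow_iterate_sound[OF assms] by (auto simp: component_of_eq)
  show "{w. reach (set A) (edge_set es) v w} \<subseteq> set (component_of es A v)"
  proof
    fix w assume "w \<in> {w. reach (set A) (edge_set es) v w}"
    then obtain p where p: "path_between (set A) (edge_set es) v w p" by (auto simp: reach_def)
    then have "length p = card (set p)" "set p \<subseteq> set A"
      by (simp_all add: path_between_def is_path_def distinct_card)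
    then have "length p \<le> length A" by (metis List.finite_set card_length card_mono le_trans)
    then show "w \<in> set (component_of es A v)"
      unfolding component_of_eq by (intro grow_iterate_complete[OF p]) simp
  qed
qed

lemma component_component_of:
  "v \<in> set A \<Longrightarrow> component (edge_set es) (set A) (set (component_of es A v))"
  by (simp add: set_component_of component_reach)

lemma component_of_filter:
  "\<exists>P. component_of es A v = filter P A"
proof -
  have "\<exists>P. ((grow es A) ^^ i) (filter (\<lambda>u. u = v) A) = filter P A" for i
    by (cases i) (auto simp: grow_def)
  then show ?thesis by (simp add: component_of_eq)
qed

lemma component_of_props:
  "set (component_of es A v) \<subseteq> set A" "length (component_of es A v) \<le> length A"
  "distinct A \<Longrightarrow> distinct (component_of es A v)"
  using component_of_filter[of es A v] by auto

lemma self_in_component_of: "v \<in> set A \<Longrightarrow> v \<in> set (component_of es A v)"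
  by (simp add: set_component_of reach_refl)

lemma component_eq_component_of:
  "component (edge_set es) (set A) D \<Longrightarrow> v \<in> D \<Longrightarrow> set (component_of es A v) = D"
  using component_eq_reach[of "edge_set es" "set A" D v] set_component_of[of v A es]
  by (auto simp: component_def)

text \<open>A shared vertex forces equal components, and both representatives are the least element
  of that component.\<close>

lemma reps_disjoint:
  assumes "v \<in> set (reps es A)" "w \<in> set (reps es A)"
    and "x \<in> set (component_of es A v)" "x \<in> set (component_of es A w)"
  shows "v = w"
proof -
  have vw: "v \<in> set A" "w \<in> set A" using assms by (auto simp: reps_def)
  have eq: "set (component_of es A v) = set (component_of es A w)"
    by (rule components_disjoint[OF component_component_of component_component_of]) (use vw assms in auto)
  have "v \<le> w" "w \<le> v"
    using assms(1,2) self_in_component_of[OF vw(1)] self_in_component_of[OF vw(2)] eq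
    by (auto simp: reps_def)
  then show ?thesis by simp
qed

lemma reps_cover: "(\<Union>v\<in>set (reps es A). set (component_of es A v)) = set A"
proof
  show "(\<Union>v\<in>set (reps es A). set (component_of es A v)) \<subseteq> set A"
    using component_of_props(1) by blast
  show "set A \<subseteq> (\<Union>v\<in>set (reps es A). set (component_of es A v))"
  proof
    fix u assume u: "u \<in> set A"
    let ?C = "set (component_of es A u)"
    have uC: "u \<in> ?C" using self_in_component_of[OF u] .
    define v where "v = Min ?C"
    have v: "v \<in> ?C" "\<forall>w\<in>?C. v \<le> w"
      unfolding v_def using uC by (auto intro: Min_in)
    have "set (component_of es A v) = ?C"
      by (rule component_eq_component_of[OF component_component_of[OF u] v(1)])
    moreover have "v \<in> set A" using v(1) component_of_props(1) by blast
    ultimately have "v \<in> set (reps es A)" "u \<in> set (component_of es A v)"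
      using v(2) uC by (auto simp: reps_def)
    then show "u \<in> (\<Union>v\<in>set (reps es A). set (component_of es A v))" by blast
  qed
qed

text \<open>The components partition \<open>A\<close>, each counted once through its representative.
  With \<open>g\<close> constantly 1 this counts vertices; with a potential it splits the budget of
  a piece among its subpieces.\<close>

lemma sum_over_components:
  fixes g :: "nat \<Rightarrow> nat"
  assumes "distinct A"
  shows "(\<Sum>v\<leftarrow>reps es A. \<Sum>u\<in>set (component_of es A v). g u) = (\<Sum>u\<in>set A. g u)"
proof -
  have "distinct (reps es A)" using assms by (simp add: reps_def)
  then have "(\<Sum>v\<leftarrow>reps es A. \<Sum>u\<in>set (component_of es A v). g u)
      = (\<Sum>v\<in>set (reps es A). \<Sum>u\<in>set (component_of es A v). g u)"
    by (rule sum_list_distinct_conv_sum_set)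
  also have "\<dots> = (\<Sum>u\<in>(\<Union>v\<in>set (reps es A). set (component_of es A v)). g u)"
    by (rule sum.UNION_disjoint[symmetric]) (use reps_disjoint in auto)
  finally show ?thesis by (simp add: reps_cover)
qed

section \<open>Cheapest table entries\<close>

lemma same_elems_iff: "same_elems C D \<longleftrightarrow> set C = set D"
  by (auto simp: same_elems_def)

lemma in_cheapest_iff: "s \<in> set (cheapest ss) \<longleftrightarrow> s \<in> set ss \<and> (\<forall>t\<in>set ss. cost s \<le> cost t)"
  by (auto simp: cheapest_def)

lemma lookup_cases:
  "lookup tab L = [] \<or> (\<exists>s C. lookup tab L = [s] \<and> (C, s) \<in> set tab \<and> set C = set L)"
proof (cases "lookup tab L = []")
  case False
  let ?ss = "cheapest (map snd (filter (\<lambda>e. same_elems (fst e) L) tab))"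
  have ne: "?ss \<noteq> []" and eq: "lookup tab L = [hd ?ss]"
    using False by (auto simp: lookup_def Let_def split: if_splits)
  have "hd ?ss \<in> set ?ss" using ne by simp
  then have "\<exists>C. (C, hd ?ss) \<in> set tab \<and> set C = set L"
    by (auto simp: cheapest_def same_elems_iff)
  then show ?thesis using eq by blast
qed simp

lemma lookup_best:
  assumes "(C, s) \<in> set tab" "set C = set L"
  shows "\<exists>t. lookup tab L = [t] \<and> cost t \<le> cost s"
proof -
  let ?all = "map snd (filter (\<lambda>e. same_elems (fst e) L) tab)"
  have s: "s \<in> set ?all" using assms by (force simp: same_elems_iff)
  then obtain t where "t \<in> set ?all" "\<forall>u\<in>set ?all. cost t \<le> cost u"
    using ex_min_if_finite[of "cost ` set ?all"] arg_min_if_finite[of "set ?all" cost]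
    by (metis List.finite_set empty_iff not_less)
  then have "t \<in> set (cheapest ?all)" unfolding in_cheapest_iff by blast
  then have ne: "cheapest ?all \<noteq> []" by auto
  then have "hd (cheapest ?all) \<in> set (cheapest ?all)" by simp
  then have "cost (hd (cheapest ?all)) \<le> cost s" using s unfolding in_cheapest_iff by blast
  then show ?thesis using ne by (simp add: lookup_def Let_def)
qed

lemma set_improve:
  "set (improve es Cs tab) = {(C, s). C \<in> set Cs \<and> (\<exists>r\<in>set C. s \<in> set (extend es tab C r))}"
  by (auto simp: improve_def)

lemma table_eq: "table n es Cs = (improve es Cs ^^ n) []"
  unfolding table_def foldl_const by simp

section \<open>Enumeration of the pieces\<close>

lemma complements_Suc:
  "complements n (Suc k) = concat (map (\<lambda>A. map (\<lambda>s. filter (\<lambda>x. x \<noteq> s) A) [0..<n + 1]) (complements n k))"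
  by (simp add: complements_def)

lemma complements_props:
  "A \<in> set (complements n k) \<Longrightarrow> set A \<subseteq> {..<n} \<and> distinct A \<and> length A \<le> n"
proof (induction k arbitrary: A)
  case 0
  then show ?case by (auto simp: complements_def)
next
  case (Suc k)
  then obtain B s where "B \<in> set (complements n k)" "A = filter (\<lambda>x. x \<noteq> s) B"
    by (auto simp: complements_Suc)
  then show ?case using Suc.IH[of B] le_trans[OF length_filter_le[of "\<lambda>x. x \<noteq> s" B]] by auto
qed

lemma complements_complete:
  "S \<subseteq> {..<n} \<Longrightarrow> card S \<le> k \<Longrightarrow> \<exists>A\<in>set (complements n k). set A = {..<n} - S"
proof (induction k arbitrary: S)
  case 0
  then have "S = {}" using finite_subset by fastforce
  then show ?case by (auto simp: complements_def)
next
  case (Suc k)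
  obtain s S' where s: "s \<in> {..<n + 1}" "S' \<subseteq> {..<n}" "card S' \<le> k" "{..<n} - S = ({..<n} - S') - {s}"
  proof (cases "S = {}")
    case True
    show ?thesis by (rule that[of n "{}"]) (use True in auto)
  next
    case False
    then obtain s where s: "s \<in> S" by blast
    have "finite S" using Suc.prems finite_subset by blast
    then show ?thesis by (intro that[of s "S - {s}"]) (use s Suc.prems in auto)
  qed
  obtain A where A: "A \<in> set (complements n k)" "set A = {..<n} - S'" using Suc.IH s by blast
  have "s \<in> set [0..<n + 1]" using s(1) by auto
  then have "filter (\<lambda>x. x \<noteq> s) A \<in> set (map (\<lambda>s. filter (\<lambda>x. x \<noteq> s) A) [0..<n + 1])"
    unfolding set_map by (rule imageI)
  then have "filter (\<lambda>x. x \<noteq> s) A \<in> set (complements n (Suc k))"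
    unfolding complements_Suc set_concat set_map[of _ "complements n k"] by (intro UN_I[OF imageI[OF A(1)]])
  moreover have "set (filter (\<lambda>x. x \<noteq> s) A) = {..<n} - S" using A(2) s(4) by auto
  ultimately show ?case by blast
qed

text \<open>This count is the source of the exponent \<open>k\<close> in the running time.\<close>

lemma length_complements: "length (complements n k) = (n + 1) ^ k"
proof (induction k)
  case (Suc k)
  have "length (concat (map (\<lambda>A. map (f A) [0..<n + 1]) xs)) = (n + 1) * length xs"
    for f :: "nat list \<Rightarrow> nat \<Rightarrow> nat list" and xs
    by (induction xs) auto
  then show ?case using Suc by (simp add: complements_Suc del: upt_Suc)
qed (simp add: complements_def)

lemma pieces_props:
  assumes "C \<in> set (pieces n es k)"
  shows "set C \<subseteq> {..<n}" "distinct C" "connected_in (edge_set es) (set C)" "length C \<le> n"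
proof -
  obtain A v where A: "A \<in> set (complements n k)" "v \<in> set A" and C: "C = component_of es A v"
    using assms by (auto simp: pieces_def)
  show "set C \<subseteq> {..<n}" "distinct C"
    using complements_props[OF A(1)] component_of_props(1)[of es A v] component_of_props(3)[of A es v] C by auto
  show "length C \<le> n"
    using complements_props[OF A(1)] component_of_props(2)[of es A v] C by simp
  show "connected_in (edge_set es) (set C)"
    using component_component_of[OF A(2), of es] C by (simp add: component_def)
qed

lemma pieces_complete:
  assumes "S \<subseteq> {..<n}" "card S \<le> k" "component (edge_set es) ({..<n} - S) C"
  shows "\<exists>L\<in>set (pieces n es k). set L = C"
proof -
  obtain A where A: "A \<in> set (complements n k)" "set A = {..<n} - S"
    using complements_complete[OF assms(1,2)] by blast
  obtain v where v: "v \<in> C" "v \<in> set A" using assms(3) A(2) by (auto simp: component_def)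
  have "set (component_of es A v) = C"
    by (rule component_eq_component_of) (use assms(3) A(2) v in simp_all)
  moreover have "component_of es A v \<in> set (pieces n es k)" using A v by (auto simp: pieces_def)
  ultimately show ?thesis by blast
qed


section \<open>Soundness of the table entries\<close>

locale tree_instance =
  fixes n :: nat and es :: "(nat \<times> nat) list"
  assumes tree_input: "tree_input n es"
begin

abbreviation "V \<equiv> {..<n}"
abbreviation "E \<equiv> edge_set es"

lemma acyclic: "acyclic_graph V E"
  using tree_input by (simp add: tree_input_def is_tree_def acyclic_graph_def)

lemma connected_V: "connected_in E V"
  using tree_input by (simp add: tree_input_def is_tree_def connected_in_def reach_def)

lemma n_pos: "0 < n"
  using tree_input by (auto simp: tree_input_def is_tree_def)

lemma length_es: "length es \<le> n * n"
proof -
  have "distinct es" using tree_input by (simp add: tree_input_def distinct_map)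
  moreover have "set es \<subseteq> V \<times> V"
  proof
    fix e assume e: "e \<in> set es"
    obtain u v where uv: "e = (u, v)" by force
    then have "{u, v} \<in> E" using e by (force simp: edge_set_def)
    then obtain a b where "a \<in> V" "b \<in> V" "{u, v} = {a, b}"
      using tree_input unfolding tree_input_def is_tree_def simple_graph_def by blast
    then show "e \<in> V \<times> V" using uv by (auto simp: doubleton_eq_iff)
  qed
  ultimately have "length es \<le> card (V \<times> V)"
    by (metis card_mono distinct_card finite_SigmaI finite_lessThan)
  then show ?thesis by simp
qed

text \<open>The bound on \<open>length s\<close> serves the running time: it keeps table entries
  small. The last clause asks for one entry that covers \<open>u\<close> and \<open>v\<close>
  together, which makes its root a common hub on their path.\<close>

definition valid :: "nat set \<Rightarrow> solution \<Rightarrow> bool" where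
  "valid C s \<longleftrightarrow> length s \<le> card C
     \<and> (\<forall>p\<in>set s. fst p \<in> V \<and> set (snd p) \<subseteq> V \<and> distinct (snd p))
     \<and> (\<forall>u\<in>C. \<forall>v\<in>C. \<exists>p\<in>set s. u \<in> set (snd p) \<and> v \<in> set (snd p) \<and> fst p \<in> path_verts V E u v)"

definition valid_table :: "nat list list \<Rightarrow> (nat list \<times> solution) list \<Rightarrow> bool" where
  "valid_table Cs tab \<longleftrightarrow> (\<forall>(C, s)\<in>set tab. C \<in> set Cs \<and> valid (set C) s)"

lemma valid_lookup:
  assumes "valid_table Cs tab" "lookup tab L = [s]"
  shows "valid (set L) s"
proof -
  obtain C where "(C, s) \<in> set tab" "set C = set L"
    using lookup_cases[of tab L] assms(2) by auto
  then show ?thesis using assms(1) unfolding valid_table_def by fastforce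
qed

text \<open>Vertices separated by \<open>r\<close> are covered by the new entry, since their path
  passes through \<open>r\<close>; all others share a subpiece and are covered by its solution. The
  subpieces together omit \<open>r\<close>, which leaves room for one more entry in the length
  bound.\<close>

lemma valid_join:
  assumes C: "set C \<subseteq> V" "distinct C" "connected_in E (set C)" "r \<in> set C"
  defines "A \<equiv> filter (\<lambda>x. x \<noteq> r) C"
  assumes sol: "\<And>v. v \<in> set (reps es A) \<Longrightarrow> valid (set (component_of es A v)) (sol v)"
  shows "valid (set C) ((r, C) # concat (map sol (reps es A)))"
  unfolding valid_def
proof (intro conjI ballI)
  have A: "set A = set C - {r}" "distinct A" using C by (auto simp: A_def)
  have "length (concat (map sol (reps es A))) = (\<Sum>v\<leftarrow>reps es A. length (sol v))"
    by (simp add: length_concat comp_def)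
  also have "\<dots> \<le> (\<Sum>v\<leftarrow>reps es A. \<Sum>u\<in>set (component_of es A v). 1)"
  proof (rule sum_list_mono)
    fix v assume "v \<in> set (reps es A)"
    from sol[OF this] show "length (sol v) \<le> (\<Sum>u\<in>set (component_of es A v). 1)"
      by (simp add: valid_def)
  qed
  also have "\<dots> = card (set A)" by (simp only: sum_over_components[OF A(2)]) simp
  also have "\<dots> = card (set C) - 1" using A(1) C(4) by simp
  finally have "length (concat (map sol (reps es A))) \<le> card (set C) - 1" .
  moreover have "0 < card (set C)" using C(4) by (auto simp: card_gt_0_iff)
  ultimately show "length ((r, C) # concat (map sol (reps es A))) \<le> card (set C)" by simp
next
  fix p assume p: "p \<in> set ((r, C) # concat (map sol (reps es A)))"
  have "(fst p \<in> V \<and> set (snd p) \<subseteq> V \<and> distinct (snd p))"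
  proof (cases "p = (r, C)")
    case True
    then show ?thesis using C by auto
  next
    case False
    then obtain v where "v \<in> set (reps es A)" "p \<in> set (sol v)" using p by auto
    then show ?thesis using sol[of v, unfolded valid_def] by blast
  qed
  then show "fst p \<in> V" "set (snd p) \<subseteq> V" "distinct (snd p)" by auto
next
  have A: "set A = set C - {r}" by (auto simp: A_def)
  fix u v assume uv: "u \<in> set C" "v \<in> set C"
  show "\<exists>p\<in>set ((r, C) # concat (map sol (reps es A))).
      u \<in> set (snd p) \<and> v \<in> set (snd p) \<and> fst p \<in> path_verts V E u v"
  proof (cases "reach (set C - {r}) E u v")
    \<comment> \<open>This includes \<open>u = r\<close> and \<open>v = r\<close>, as
      \<open>r\<close> is not reachable in \<open>C - {r}\<close>.\<close>
    case False
    then have "r \<in> path_verts V E u v"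
      by (rule separator_in_path_verts[OF acyclic C(1,3) uv])
    then show ?thesis using uv by simp
  next
    case True
    then have "u \<in> set A" using reach_in[OF True] A by simp
    then have "u \<in> (\<Union>v\<in>set (reps es A). set (component_of es A v))" by (simp only: reps_cover)
    then obtain w where w: "w \<in> set (reps es A)" "u \<in> set (component_of es A w)" by blast
    have "w \<in> set A" using w(1) by (auto simp: reps_def)
    then have "v \<in> set (component_of es A w)"
      using w(2) A reach_trans[OF True, of w] by (simp add: set_component_of)
    then obtain p where "p \<in> set (sol w)" "u \<in> set (snd p)" "v \<in> set (snd p)" "fst p \<in> path_verts V E u v"
      using sol[OF w(1), unfolded valid_def] w(2) by blast
    moreover from this(1) have "p \<in> set ((r, C) # concat (map sol (reps es A)))" using w(1) by auto
    ultimately show ?thesis by blast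
  qed
qed

lemma extend_cases:
  assumes "s \<in> set (extend es tab C r)"
  shows "\<exists>sol. (\<forall>v\<in>set (reps es (filter (\<lambda>x. x \<noteq> r) C)).
      lookup tab (component_of es (filter (\<lambda>x. x \<noteq> r) C) v) = [sol v])
    \<and> s = (r, C) # concat (map sol (reps es (filter (\<lambda>x. x \<noteq> r) C)))"
proof -
  define A where "A = filter (\<lambda>x. x \<noteq> r) C"
  let ?l = "\<lambda>v. lookup tab (component_of es A v)"
  have ne': "\<not> (\<exists>s\<in>set (map ?l (reps es A)). s = [])"
    and s: "s = (r, C) # concat (concat (map ?l (reps es A)))"
    using assms unfolding extend_def A_def[symmetric] Let_def
    by (simp_all only: if_False if_True not_False_eq_True list.set empty_iff singleton_iff split: if_splits)
  have ne: "\<forall>v\<in>set (reps es A). ?l v \<noteq> []"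
    using ne' unfolding set_map by blast
  have l: "?l v = [hd (?l v)]" if "v \<in> set (reps es A)" for v
    using lookup_cases[of tab "component_of es A v"] ne that by (metis list.sel(1))
  have "concat (map ?l vs) = map (\<lambda>v. hd (?l v)) vs" if "set vs \<subseteq> set (reps es A)" for vs
    using that
  proof (induction vs)
    case (Cons v vs)
    then have "concat (map ?l (v # vs)) = ?l v @ map (\<lambda>v. hd (?l v)) vs" by simp
    also have "?l v = [hd (?l v)]" using l Cons.prems by simp
    finally show ?case by simp
  qed simp
  then have "s = (r, C) # concat (map (\<lambda>v. hd (?l v)) (reps es A))" using s by simp
  then show ?thesis using l unfolding A_def by (intro exI conjI ballI)
qed

lemma extend_complete:
  assumes "\<And>v. v \<in> set (reps es (filter (\<lambda>x. x \<noteq> r) C)) \<Longrightarrow>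
      lookup tab (component_of es (filter (\<lambda>x. x \<noteq> r) C) v) = [sol v]"
  shows "(r, C) # concat (map sol (reps es (filter (\<lambda>x. x \<noteq> r) C))) \<in> set (extend es tab C r)"
proof -
  define A where "A = filter (\<lambda>x. x \<noteq> r) C"
  let ?l = "\<lambda>v. lookup tab (component_of es A v)"
  have m: "map ?l (reps es A) = map (\<lambda>v. [sol v]) (reps es A)"
    using assms by (simp add: A_def)
  have "concat (map (\<lambda>v. [sol v]) vs) = map sol vs" for vs by (induction vs) auto
  then show ?thesis
    unfolding extend_def A_def[symmetric] Let_def m by auto
qed

lemma valid_improve:
  assumes "valid_table (pieces n es k) tab"
  shows "valid_table (pieces n es k) (improve es (pieces n es k) tab)"
  unfolding valid_table_def
proof (clarify, intro conjI)
  fix C s assume "(C, s) \<in> set (improve es (pieces n es k) tab)"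
  then obtain r where C: "C \<in> set (pieces n es k)" and r: "r \<in> set C" and s: "s \<in> set (extend es tab C r)"
    by (auto simp: set_improve)
  show "C \<in> set (pieces n es k)" by (fact C)
  let ?A = "filter (\<lambda>x. x \<noteq> r) C"
  obtain sol where sol: "\<forall>v\<in>set (reps es ?A). lookup tab (component_of es ?A v) = [sol v]"
    and s: "s = (r, C) # concat (map sol (reps es ?A))"
    using extend_cases[OF s] by (elim exE conjE) (rule that)
  show "valid (set C) s" unfolding s
    by (rule valid_join[OF pieces_props(1-3)[OF C] r]) (rule valid_lookup[OF assms sol[rule_format]])
qed

lemma valid_iterate: "valid_table (pieces n es k) ((improve es (pieces n es k) ^^ i) [])"
proof (induction i)
  case 0
  then show ?case by (simp add: valid_table_def)
next
  case (Suc i)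
  then show ?case unfolding funpow.simps comp_def by (rule valid_improve)
qed

section \<open>Cost of the computed decomposition\<close>

lemma cost_join: "cost ((r, C) # concat (map sol vs)) = length C + (\<Sum>v\<leftarrow>vs. cost (sol v))"
proof -
  have "cost (concat (map sol vs)) = (\<Sum>v\<leftarrow>vs. cost (sol v))"
    by (induction vs) (auto simp: cost_def)
  then show ?thesis by (simp add: cost_def)
qed

text \<open>
  Choice of the root of a piece \<open>C\<close> with boundary \<open>S\<close>. Each vertex \<open>u\<close> of \<open>C\<close> holds the potential
  \<open>(q + 1) * card (H u \<inter> C) + card S\<close> and has to pay \<open>q\<close> for the new hub. If \<open>S\<close> is small, the root
  is taken from the Helly property of the hub sets: every \<open>H u \<inter> C\<close> shrinks and \<open>S\<close> grows by one.
  If \<open>S\<close> is full, the root halves \<open>S\<close> and the payment comes from the boundary.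
\<close>

lemma potential_separator:
  assumes H: "hub_labeling V E H"
    and S: "S \<subseteq> V" "card S \<le> 2 * q + 2" and C: "component E (V - S) C"
  shows "\<exists>r\<in>C. \<forall>D. component E (C - {r}) D \<longrightarrow> (\<exists>S'. S' \<subseteq> V \<and> card S' \<le> 2 * q + 2
    \<and> component E (V - S') D
    \<and> (\<forall>u\<in>D. q + ((q + 1) * card (H u \<inter> D) + card S') \<le> (q + 1) * card (H u \<inter> C) + card S))"
proof -
  have CV1: "C \<subseteq> V" using C by (auto simp: component_def)
  have CV: "C \<subseteq> V" "finite C" "C \<noteq> {}" "connected_in E C"
    using C CV1 finite_subset[OF CV1] by (simp_all add: component_def)
  have fS: "finite S" using S(1) finite_subset by blast
  have sub: "D \<subseteq> C" if "component E (C - {r}) D" for r D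
    using that by (auto simp: component_def)
  have fH: "finite (H u \<inter> C)" for u using CV(2) by simp
  show ?thesis
  proof (cases "card S < 2 * q + 2")
    case True
    obtain r where r: "r \<in> C"
      and sep: "\<forall>D u. component E (C - {r}) D \<longrightarrow> u \<in> C \<longrightarrow> \<not> H u \<inter> C \<subseteq> D"
      using hub_separator[OF acyclic CV H] ..
    show ?thesis
    proof (intro bexI[OF _ r] allI impI exI[of _ "insert r S"] conjI ballI)
      fix D assume D: "component E (C - {r}) D"
      show "insert r S \<subseteq> V" using r CV(1) S(1) by auto
      show "card (insert r S) \<le> 2 * q + 2" using True fS by (simp add: card_insert_if)
      show "component E (V - insert r S) D"
        by (rule component_of_component[OF C D _ _ CV(1)]) simp_all
      fix u assume u: "u \<in> D"
      have "u \<in> C" using u sub[OF D] by blast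
      from sep[rule_format, OF D this] have "H u \<inter> D \<subset> H u \<inter> C" using sub[OF D] by blast
      from psubset_card_mono[OF fH this] have "card (H u \<inter> D) + 1 \<le> card (H u \<inter> C)" by simp
      \<comment> \<open>One lost hub releases \<open>q + 1\<close> units: \<open>q\<close> pay for
        the new hub and one covers the growth of \<open>S\<close>.\<close>
      then have "(q + 1) * (card (H u \<inter> D) + 1) \<le> (q + 1) * card (H u \<inter> C)"
        by (rule mult_left_mono) simp
      moreover have "card (insert r S) \<le> card S + 1" using fS by (simp add: card_insert_if)
      ultimately show "q + ((q + 1) * card (H u \<inter> D) + card (insert r S))
          \<le> (q + 1) * card (H u \<inter> C) + card S"
        by (simp add: algebra_simps)
    qed
  next
    case False
    have SC: "S \<subseteq> V - C" using S(1) C by (auto simp: component_def)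
    obtain r where r: "r \<in> C"
      and sep: "\<forall>D. component E (C - {r}) D \<longrightarrow> 2 * card (nbrs_in E S D) \<le> card S"
      using boundary_separator[OF acyclic CV fS SC] ..
    show ?thesis
    proof (intro bexI[OF _ r] allI impI)
      fix D assume D: "component E (C - {r}) D"
      let ?S = "insert r (nbrs_in E S D)"
      have nS: "nbrs_in E S D \<subseteq> S" by (auto simp: nbrs_in_def)
      have "card ?S \<le> card (nbrs_in E S D) + 1"
        using finite_subset[OF nS fS] by (simp add: card_insert_if)
      moreover have "2 * card (nbrs_in E S D) \<le> card S" using sep[rule_format, OF D] .
      \<comment> \<open>Here \<open>card S = 2 * q + 2\<close>. At most \<open>q + 1\<close> of its
        members survive and \<open>r\<close> joins them, so at least \<open>q\<close> units are
        released; this is the origin of the capacity \<open>2 * q + 2\<close>.\<close>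
      ultimately have half: "q + card ?S \<le> card S" using False by linarith
      show "\<exists>S'. S' \<subseteq> V \<and> card S' \<le> 2 * q + 2 \<and> component E (V - S') D
        \<and> (\<forall>u\<in>D. q + ((q + 1) * card (H u \<inter> D) + card S') \<le> (q + 1) * card (H u \<inter> C) + card S)"
      proof (intro exI[of _ ?S] conjI ballI)
        show "?S \<subseteq> V" using r CV(1) S(1) nS by auto
        show "card ?S \<le> 2 * q + 2" using half S(2) by linarith
        show "component E (V - ?S) D"
          by (rule component_of_component[OF C D _ _ CV(1)]) (use nS in \<open>auto simp: nbrs_in_def\<close>)
        fix u assume "u \<in> D"
        have "card (H u \<inter> D) \<le> card (H u \<inter> C)"
          by (rule card_mono[OF fH]) (use sub[OF D] in auto)
        then have "(q + 1) * card (H u \<inter> D) \<le> (q + 1) * card (H u \<inter> C)"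
          by (rule mult_left_mono) simp
        then show "q + ((q + 1) * card (H u \<inter> D) + card ?S) \<le> (q + 1) * card (H u \<inter> C) + card S"
          using half by linarith
      qed
    qed
  qed
qed

text \<open>The claim covers all pieces with at most \<open>i\<close> vertices and all boundaries at
  once, because a subpiece may come with a boundary unlike that of its parent. The decomposition
  guided by \<open>H\<close> need not be the one found: it only has to appear as a candidate, and
  \<open>lookup\<close> returns nothing dearer.\<close>

lemma table_complete:
  fixes q :: nat
  assumes H: "hub_labeling V E H"
  defines "Cs \<equiv> pieces n es (2 * q + 2)"
  shows "S \<subseteq> V \<Longrightarrow> card S \<le> 2 * q + 2 \<Longrightarrow> component E (V - S) C \<Longrightarrow> card C \<le> i \<Longrightarrow> set L = C \<Longrightarrow>
    \<exists>s. lookup ((improve es Cs ^^ i) []) L = [s]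
      \<and> q * cost s \<le> (\<Sum>u\<in>C. (q + 1) * card (H u \<inter> C) + card S)"
proof (induction i arbitrary: S C L)
  case 0
  have "finite C" using finite_subset[of C V] "0.prems"(3) by (auto simp: component_def)
  then have False using "0.prems"(3,4) by (auto simp: component_def)
  then show ?case ..
next
  case (Suc i)
  let ?tab = "(improve es Cs ^^ i) []"
  obtain K where K: "K \<in> set Cs" "set K = C"
    using pieces_complete[OF Suc.prems(1-3)] unfolding Cs_def by blast
  have dK: "distinct K" using pieces_props(2) K(1) unfolding Cs_def by blast
  have CV: "C \<subseteq> V" using Suc.prems(3) by (auto simp: component_def)
  obtain r where r: "r \<in> C" and sep: "\<forall>D. component E (C - {r}) D \<longrightarrow> (\<exists>S'. S' \<subseteq> V \<and> card S' \<le> 2 * q + 2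
    \<and> component E (V - S') D
    \<and> (\<forall>u\<in>D. q + ((q + 1) * card (H u \<inter> D) + card S') \<le> (q + 1) * card (H u \<inter> C) + card S))"
    using potential_separator[OF H Suc.prems(1-3)] ..
  define A where "A = filter (\<lambda>x. x \<noteq> r) K"
  have A: "set A = C - {r}" "distinct A" using K(2) dK by (auto simp: A_def)
  define g where "g u = (q + 1) * card (H u \<inter> C) + card S" for u
  have step: "\<exists>s. lookup ?tab (component_of es A v) = [s]
      \<and> q * length (component_of es A v) + q * cost s \<le> (\<Sum>u\<in>set (component_of es A v). g u)"
    if v: "v \<in> set (reps es A)" for v
  proof -
    let ?L = "component_of es A v"
    have "v \<in> set A" using v by (simp add: reps_def)
    then have D: "component E (C - {r}) (set ?L)" using component_component_of[of v A es] A(1) by simp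
    then obtain S' where S': "S' \<subseteq> V" "card S' \<le> 2 * q + 2" "component E (V - S') (set ?L)"
      and pot: "\<forall>u\<in>set ?L. q + ((q + 1) * card (H u \<inter> set ?L) + card S') \<le> g u"
      using sep unfolding g_def by blast
    have "card (set ?L) < card C"
      by (rule psubset_card_mono) (use D CV r finite_subset[of C V] in \<open>auto simp: component_def\<close>)
    then have "card (set ?L) \<le> i" using Suc.prems(4) by linarith
    from Suc.IH[OF S' this refl] obtain s where s: "lookup ?tab ?L = [s]"
      "q * cost s \<le> (\<Sum>u\<in>set ?L. (q + 1) * card (H u \<inter> set ?L) + card S')" by blast
    have "length ?L = card (set ?L)" using component_of_props(3)[OF A(2)] by (simp add: distinct_card)
    then have "q * length ?L = (\<Sum>u\<in>set ?L. q)" by simp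
    then have "q * length ?L + q * cost s
        \<le> (\<Sum>u\<in>set ?L. q) + (\<Sum>u\<in>set ?L. (q + 1) * card (H u \<inter> set ?L) + card S')"
      using s(2) by linarith
    also have "\<dots> = (\<Sum>u\<in>set ?L. q + ((q + 1) * card (H u \<inter> set ?L) + card S'))"
      by (rule sum.distrib[symmetric])
    also have "\<dots> \<le> (\<Sum>u\<in>set ?L. g u)" by (rule sum_mono) (use pot in blast)
    finally show ?thesis using s(1) by blast
  qed
  define sol where "sol v = hd (lookup ?tab (component_of es A v))" for v
  have sol: "lookup ?tab (component_of es A v) = [sol v]"
    "q * length (component_of es A v) + q * cost (sol v) \<le> (\<Sum>u\<in>set (component_of es A v). g u)"
    if v: "v \<in> set (reps es A)" for v
    using step[OF v] by (auto simp: sol_def)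
  let ?s = "(r, K) # concat (map sol (reps es A))"
  have "?s \<in> set (extend es ?tab K r)"
    unfolding A_def by (rule extend_complete) (rule sol(1)[unfolded A_def])
  then have "(K, ?s) \<in> set ((improve es Cs ^^ Suc i) [])"
    using K r by (auto simp: set_improve)
  then obtain t where t: "lookup ((improve es Cs ^^ Suc i) []) L = [t]" "cost t \<le> cost ?s"
    using lookup_best K(2) Suc.prems(5) by metis
  have lenK: "length K = 1 + length A"
  proof -
    have "length K = card C" "length A = card (C - {r})"
      using dK K(2) A by (metis distinct_card)+
    then show ?thesis using r CV finite_subset[of C V] card_Suc_Diff1[of C r] by simp
  qed
  have lenA: "length A = (\<Sum>v\<leftarrow>reps es A. length (component_of es A v))"
  proof -
    have "(\<Sum>v\<leftarrow>reps es A. length (component_of es A v))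
        = (\<Sum>v\<leftarrow>reps es A. \<Sum>u\<in>set (component_of es A v). 1)"
      using component_of_props(3)[OF A(2)] by (simp add: distinct_card)
    also have "\<dots> = card (set A)" by (simp only: sum_over_components[OF A(2)]) simp
    finally show ?thesis using A(2) by (simp add: distinct_card)
  qed
  have "q * cost t \<le> q * cost ?s" using t(2) by simp
  also have "\<dots> = q + (\<Sum>v\<leftarrow>reps es A. q * length (component_of es A v) + q * cost (sol v))"
    unfolding cost_join lenK lenA
    by (simp add: algebra_simps sum_list_addf sum_list_const_mult)
  also have "\<dots> \<le> q + (\<Sum>v\<leftarrow>reps es A. \<Sum>u\<in>set (component_of es A v). g u)"
    by (intro add_left_mono sum_list_mono) (rule sol(2))
  also have "\<dots> = q + (\<Sum>u\<in>C - {r}. g u)" by (simp only: sum_over_components[OF A(2)] A(1))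
  \<comment> \<open>The leading \<open>q\<close> is the price of \<open>r\<close> as a hub of
    itself, and \<open>r\<close> lies in no subpiece. Its own potential suffices, because the
    labeling condition for \<open>u = v = r\<close> puts some vertex of \<open>C\<close> into
    \<open>H r\<close>.\<close>
  also have "\<dots> \<le> g r + (\<Sum>u\<in>C - {r}. g u)"
  proof -
    have "r \<in> V" using r CV by blast
    have "H r \<inter> H r \<inter> path_verts V E r r \<noteq> {}"
      using H[unfolded hub_labeling_def, THEN conjunct2, rule_format, OF \<open>r \<in> V\<close> \<open>r \<in> V\<close>] .
    moreover have "path_verts V E r r \<subseteq> C"
      by (rule path_verts_in_connected[OF acyclic CV _ r r]) (use Suc.prems(3) in \<open>simp add: component_def\<close>)
    ultimately have "H r \<inter> C \<noteq> {}" by auto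
    moreover have "finite (H r \<inter> C)" using CV finite_subset[of C V] by simp
    ultimately have "1 \<le> card (H r \<inter> C)" by (simp add: Suc_le_eq card_gt_0_iff)
    then have "(q + 1) * 1 \<le> (q + 1) * card (H r \<inter> C)" by (rule mult_left_mono) simp
    then have "q \<le> g r" unfolding g_def by simp
    then show ?thesis by simp
  qed
  also have "\<dots> = (\<Sum>u\<in>C. g u)"
    using r CV finite_subset[of C V] by (simp add: sum.remove[symmetric])
  finally show ?case using t(1) unfolding g_def by blast
qed

lemma hub_algorithm_correct:
  fixes q :: nat
  defines "hs \<equiv> hub_algorithm (2 * q + 2) n es"
  shows "length hs = n" "hub_labeling V E (labels_of hs)"
    "q * hl1_cost V (labels_of hs) \<le> (q + 1) * hl1_opt V E"
proof -
  let ?Cs = "pieces n es (2 * q + 2)"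
  \<comment> \<open>The labeling by all vertices shows that the set of attainable costs is nonempty,
    so the \<open>LEAST\<close> in \<open>hl1_opt\<close> is attained.\<close>
  have hl: "hub_labeling V E (\<lambda>_. V)"
    unfolding hub_labeling_def
  proof (intro conjI ballI)
    fix u v assume uv: "u \<in> V" "v \<in> V"
    obtain p where p: "path_between V E u v p" using connected_in_path[OF connected_V uv] .
    have "u \<in> path_verts V E u v"
      using acyclic_graph_path_verts[OF acyclic p] path_between_ends[OF p] by simp
    then show "V \<inter> V \<inter> path_verts V E u v \<noteq> {}" using uv by auto
  qed simp
  then have "\<exists>k. \<exists>H. hub_labeling V E H \<and> hl1_cost V H = k" by blast
  from LeastI_ex[OF this] obtain H where H: "hub_labeling V E H" "hl1_cost V H = hl1_opt V E"
    unfolding hl1_opt_def by blast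
  \<comment> \<open>The whole tree is a piece with empty boundary, so its potential is just
    \<open>q + 1\<close> times the optimum.\<close>
  have comp: "component E (V - {}) V"
    using connected_V n_pos by (auto simp: component_def)
  have tab: "(improve es ?Cs ^^ n) [] = table n es ?Cs" by (rule table_eq[symmetric])
  obtain s where s: "lookup (table n es ?Cs) [0..<n] = [s]"
    and cs: "q * cost s \<le> (\<Sum>u\<in>V. (q + 1) * card (H u \<inter> V) + card ({} :: nat set))"
  proof -
    have "\<exists>s. lookup ((improve es ?Cs ^^ n) []) [0..<n] = [s]
      \<and> q * cost s \<le> (\<Sum>u\<in>V. (q + 1) * card (H u \<inter> V) + card ({} :: nat set))"
      by (rule table_complete[OF H(1) _ _ comp]) (simp_all add: atLeast0LessThan)
    then show ?thesis using that unfolding tab by blast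
  qed
  have hs: "hs = labels n s" unfolding hs_def hub_algorithm_def s by simp
  have "valid_table ?Cs (table n es ?Cs)" unfolding table_eq by (rule valid_iterate)
  from valid_lookup[OF this s] have valid: "valid V s" by (simp add: atLeast0LessThan)
  have lab: "labels_of hs u = {h. \<exists>D. (h, D) \<in> set s \<and> u \<in> set D}" if "u < n" for u
    using that by (force simp: labels_of_def hs labels_def)
  show len: "length hs = n" by (simp add: hs labels_def)
  show "hub_labeling V E (labels_of hs)"
    unfolding hub_labeling_def
  proof (intro conjI ballI)
    fix u assume "u \<in> V"
    then show "labels_of hs u \<subseteq> V" using valid by (auto simp: lab valid_def)
  next
    fix u v assume uv: "u \<in> V" "v \<in> V"
    then obtain p where "p \<in> set s" "u \<in> set (snd p)" "v \<in> set (snd p)" "fst p \<in> path_verts V E u v"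
      using valid unfolding valid_def by blast
    moreover from this(1-3) have "fst p \<in> labels_of hs u" "fst p \<in> labels_of hs v"
      using uv lab by (metis (mono_tags, lifting) lessThan_iff mem_Collect_eq prod.collapse)+
    ultimately have "fst p \<in> labels_of hs u \<inter> labels_of hs v \<inter> path_verts V E u v" by blast
    then show "labels_of hs u \<inter> labels_of hs v \<inter> path_verts V E u v \<noteq> {}" by blast
  qed
  \<comment> \<open>Double counting of the pairs of a vertex and an entry whose piece contains
    it.\<close>
  have count: "(\<Sum>u<n. length (filter (\<lambda>p. \<exists>x\<in>set (snd p). x = u) xs)) = cost xs"
    if "\<forall>p\<in>set xs. set (snd p) \<subseteq> V \<and> distinct (snd p)" for xs :: solution
    using that
  proof (induction xs)
    case Nil
    then show ?case by (simp add: cost_def)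
  next
    case (Cons p xs)
    have "(\<Sum>u<n. if \<exists>x\<in>set (snd p). x = u then 1 else 0 :: nat) = card (set (snd p))"
    proof -
      have "(\<Sum>u<n. if \<exists>x\<in>set (snd p). x = u then 1 else 0 :: nat)
          = (\<Sum>u\<in>V. if u \<in> set (snd p) then 1 else 0)" by (rule sum.cong) auto
      also have "\<dots> = (\<Sum>u\<in>V \<inter> set (snd p). 1)" by (simp only: sum.inter_restrict[OF finite_lessThan])
      also have "V \<inter> set (snd p) = set (snd p)" using Cons.prems by auto
      finally show ?thesis by simp
    qed
    moreover have "(\<Sum>u<n. length (filter (\<lambda>p. \<exists>x\<in>set (snd p). x = u) (p # xs)))
        = (\<Sum>u<n. (if \<exists>x\<in>set (snd p). x = u then 1 else 0)
            + length (filter (\<lambda>p. \<exists>x\<in>set (snd p). x = u) xs))"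
      by (rule sum.cong) auto
    ultimately show ?case
      using Cons by (simp add: cost_def sum.distrib distinct_card)
  qed
  \<comment> \<open>Only an inequality: a list of hubs may repeat an element, while the cost is
    measured on sets.\<close>
  have "hl1_cost V (labels_of hs) \<le> (\<Sum>u<n. length (filter (\<lambda>p. \<exists>x\<in>set (snd p). x = u) s))"
    unfolding hl1_cost_def
  proof (rule sum_mono)
    fix u assume "u \<in> V"
    then have "labels_of hs u = set (map fst (filter (\<lambda>p. \<exists>x\<in>set (snd p). x = u) s))"
      by (simp add: labels_of_def hs labels_def)
    then show "card (labels_of hs u) \<le> length (filter (\<lambda>p. \<exists>x\<in>set (snd p). x = u) s)"
      using card_length[of "map fst (filter (\<lambda>p. \<exists>x\<in>set (snd p). x = u) s)"] by simp
  qed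
  also have "\<dots> = cost s" by (rule count) (use valid in \<open>simp add: valid_def\<close>)
  finally have "q * hl1_cost V (labels_of hs) \<le> q * cost s" by simp
  also have "\<dots> \<le> (\<Sum>u\<in>V. (q + 1) * card (H u))"
  proof -
    have "H u \<inter> V = H u" if "u \<in> V" for u using H(1) that by (auto simp: hub_labeling_def)
    then have "(\<Sum>u\<in>V. (q + 1) * card (H u \<inter> V) + card ({} :: nat set)) = (\<Sum>u\<in>V. (q + 1) * card (H u))"
      by (intro sum.cong) auto
    then show ?thesis using cs by simp
  qed
  also have "\<dots> = (q + 1) * hl1_opt V E"
    unfolding H(2)[symmetric] hl1_cost_def by (rule sum_distrib_left[symmetric])
  finally show "q * hl1_cost V (labels_of hs) \<le> (q + 1) * hl1_opt V E" .
qed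

end

section \<open>Running time\<close>

lemmas ptime_basic = ptime_id ptime_const_nat ptime_Nil ptime_fst ptime_snd ptime_Pair ptime_Cons
  ptime_add ptime_less ptime_eq_nat ptime_le_nat ptime_not ptime_and ptime_or ptime_is_Nil

text \<open>The function is first treated on a tuple, where the combinators see only projections and
  the size conditions form the domain; \<open>ptime_comp\<close> then transports it to arbitrary
  arguments. Most of the following lemmas repeat this pattern.\<close>

lemma ptime_adjacent:
  assumes "ptime D es" "ptime D u" "ptime D v" and len: "\<And>M c. D M c \<Longrightarrow> length (es c) \<le> M"
  shows "ptime D (\<lambda>c. adjacent (es c) (u c) (v c))"
proof -
  have "ptime (\<lambda>M c. length (fst c) \<le> M) (\<lambda>c. adjacent (fst c) (fst (snd c)) (snd (snd c)))"
    unfolding adjacent_def by (intro ptime_bex ptime_basic) (auto intro: pbounded_linear)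
  from ptime_comp[OF this ptime_Pair[OF assms(1) ptime_Pair[OF assms(2,3)]]] len
  show ?thesis by simp
qed

lemma ptime_grow:
  assumes "ptime D es" "ptime D A" "ptime D X"
    and len: "\<And>M c. D M c \<Longrightarrow> length (es c) \<le> M \<and> length (A c) \<le> M \<and> length (X c) \<le> M"
  shows "ptime D (\<lambda>c. grow (es c) (A c) (X c))"
proof -
  have "ptime (\<lambda>M c. length (fst c) \<le> M \<and> length (fst (snd c)) \<le> M \<and> length (snd (snd c)) \<le> M)
      (\<lambda>c. grow (fst c) (fst (snd c)) (snd (snd c)))"
    unfolding grow_def
    by (intro ptime_filter ptime_bex ptime_or ptime_eq_nat ptime_adjacent ptime_basic)
      (auto intro: pbounded_linear)
  from ptime_comp[OF this ptime_Pair[OF assms(1) ptime_Pair[OF assms(2,3)]]] len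
  show ?thesis by simp
qed

lemma ptime_component_of:
  assumes "ptime D es" "ptime D A" "ptime D v"
    and len: "\<And>M c. D M c \<Longrightarrow> length (es c) \<le> M \<and> length (A c) \<le> M"
  shows "ptime D (\<lambda>c. component_of (es c) (A c) (v c))"
proof -
  let ?D = "\<lambda>M c. length (fst c) \<le> M \<and> length (fst (snd c)) \<le> M"
  let ?D' = "\<lambda>M p. ?D M (fst p) \<and> length (snd (snd p)) \<le> M"
  let ?g = "\<lambda>p. grow (fst (fst p)) (fst (snd (fst p))) (snd (snd p))"
  have g: "ptime ?D' ?g"
    by (intro ptime_grow ptime_basic) auto
  have "ptime ?D (\<lambda>c. foldl (\<lambda>X x. ?g (c, x, X)) (filter (\<lambda>u. u = snd (snd c)) (fst (snd c))) (fst (snd c)))"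
  \<comment> \<open>Since \<open>grow\<close> filters the list of allowed vertices, the accumulator
    never outgrows \<open>M\<close>.\<close>
  proof (rule ptime_foldl[OF _ _ g, where I = "\<lambda>M c X. length X \<le> M"])
    show "ptime ?D (\<lambda>c. fst (snd c))" by (intro ptime_basic)
    show "ptime ?D (\<lambda>c. filter (\<lambda>u. u = (snd (snd c) :: nat)) (fst (snd c)))"
      by (intro ptime_filter ptime_basic) (auto intro: pbounded_linear)
  qed (auto intro: pbounded_linear le_trans[OF length_filter_le] simp: grow_def)
  then have "ptime ?D (\<lambda>c. component_of (fst c) (fst (snd c)) (snd (snd c)))"
    by (simp add: component_of_def)
  from ptime_comp[OF this ptime_Pair[OF assms(1) ptime_Pair[OF assms(2,3)]]] len
  show ?thesis by simp
qed

lemma ptime_reps: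
  assumes "ptime D es" "ptime D A"
    and len: "\<And>M c. D M c \<Longrightarrow> length (es c) \<le> M \<and> length (A c) \<le> M"
  shows "ptime D (\<lambda>c. reps (es c) (A c))"
proof -
  have "ptime (\<lambda>M c. length (fst c) \<le> M \<and> length (snd c) \<le> M) (\<lambda>c. reps (fst c) (snd c))"
    unfolding reps_def
    by (intro ptime_filter ptime_ball ptime_component_of ptime_basic)
      (auto intro!: pbounded_linear intro: le_trans[OF component_of_props(2)])
  from ptime_comp[OF this ptime_Pair[OF assms(1,2)]] len
  show ?thesis by simp
qed

section \<open>Size bounds for solutions and tables\<close>

text \<open>Only list lengths are bounded, since adding or comparing numbers costs one step whatever
  their size.\<close>

definition bounded_solution :: "nat \<Rightarrow> solution \<Rightarrow> bool" where
  "bounded_solution M s \<longleftrightarrow> length s \<le> M \<and> (\<forall>p\<in>set s. length (snd p) \<le> M)"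

definition bounded_table :: "nat \<Rightarrow> (nat list \<times> solution) list \<Rightarrow> bool" where
  "bounded_table M tab \<longleftrightarrow> length tab \<le> M
     \<and> (\<forall>e\<in>set tab. length (fst e) \<le> M \<and> bounded_solution M (snd e))"

lemma ptime_cost:
  assumes "ptime D s" and len: "\<And>M c. D M c \<Longrightarrow> bounded_solution M (s c)"
  shows "ptime D (\<lambda>c. cost (s c))"
proof -
  have "ptime bounded_solution (\<lambda>s. cost s)"
    unfolding cost_def
    by (intro ptime_sum_list ptime_map ptime_length ptime_basic)
      (auto intro!: pbounded_linear simp: bounded_solution_def)
  from ptime_comp[OF this assms(1)] len show ?thesis by blast
qed

lemma ptime_same_elems:
  assumes "ptime D C" "ptime D C'" and len: "\<And>M c. D M c \<Longrightarrow> length (C c) \<le> M \<and> length (C' c) \<le> M"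
  shows "ptime D (\<lambda>c. same_elems (C c) (C' c))"
proof -
  have "ptime (\<lambda>M c. length (fst c) \<le> M \<and> length (snd c) \<le> M) (\<lambda>c. same_elems (fst c) (snd c))"
    unfolding same_elems_def
    by (intro ptime_and ptime_ball ptime_bex ptime_basic) (auto intro!: pbounded_linear)
  from ptime_comp[OF this ptime_Pair[OF assms(1,2)]] len show ?thesis by simp
qed

lemma ptime_cheapest:
  assumes "ptime D ss"
    and len: "\<And>M c. D M c \<Longrightarrow> length (ss c) \<le> M \<and> (\<forall>s\<in>set (ss c). bounded_solution M s)"
  shows "ptime D (\<lambda>c. cheapest (ss c))"
proof -
  have "ptime (\<lambda>M ss. length ss \<le> M \<and> (\<forall>s\<in>set ss. bounded_solution M s)) (\<lambda>ss. cheapest ss)"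
    unfolding cheapest_def
    by (intro ptime_filter ptime_ball ptime_cost ptime_basic) (auto intro!: pbounded_linear)
  from ptime_comp[OF this assms(1)] len show ?thesis by blast
qed

lemma ptime_lookup:
  assumes "ptime D tab" "ptime D C"
    and len: "\<And>M c. D M c \<Longrightarrow> bounded_table M (tab c) \<and> length (C c) \<le> M"
  shows "ptime D (\<lambda>c. lookup (tab c) (C c))"
proof -
  have "ptime (\<lambda>M c. bounded_table M (fst c) \<and> length (snd c) \<le> M) (\<lambda>c. lookup (fst c) (snd c))"
    unfolding lookup_def
    by (intro ptime_let ptime_if ptime_hd ptime_cheapest ptime_map ptime_filter ptime_same_elems ptime_basic)
      (auto intro!: pbounded_linear intro: le_trans[OF length_filter_le] simp: bounded_table_def)
  from ptime_comp[OF this ptime_Pair[OF assms(1,2)]] len show ?thesis by simp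
qed

lemma length_lookup: "length (lookup tab C) \<le> 1"
  by (simp add: lookup_def Let_def)

lemma lookup_bounded: "bounded_table M tab \<Longrightarrow> s \<in> set (lookup tab C) \<Longrightarrow> bounded_solution M s"
  using lookup_cases[of tab C] by (force simp: bounded_table_def)

lemma length_extend: "length (extend es tab C r) \<le> 1"
  by (simp add: extend_def Let_def)


lemma ptime_extend:
  assumes "ptime D es" "ptime D tab" "ptime D C" "ptime D r"
    and len: "\<And>M c. D M c \<Longrightarrow> length (es c) \<le> M \<and> bounded_table M (tab c) \<and> length (C c) \<le> M"
  shows "ptime D (\<lambda>c. extend (es c) (tab c) (C c) (r c))"
proof -
  let ?D = "\<lambda>M (c :: (nat \<times> nat) list \<times> (nat list \<times> solution) list \<times> nat list \<times> nat).
    length (fst c) \<le> M \<and> bounded_table M (fst (snd c)) \<and> length (fst (snd (snd c))) \<le> M"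
  have 1: "length (filter P C) \<le> M" if "length C \<le> M" for P :: "nat \<Rightarrow> bool" and C M
    using that le_trans[OF length_filter_le] by blast
  have 2: "length (reps es A) \<le> length A" for es A
    by (simp add: reps_def)
  have 3: "length (concat (map (\<lambda>v. lookup tab (f v)) vs)) \<le> M" if "length vs \<le> M"
    for tab and f :: "nat \<Rightarrow> nat list" and vs M
    using length_concat_le[of "map (\<lambda>v. lookup tab (f v)) vs" 1] length_lookup that by fastforce
  \<comment> \<open>\<open>Suc (Suc M)\<close> is the inner bound \<open>(M + 2) ^ 1\<close> of
    \<open>ptime_concat\<close> in simplified form.\<close>
  have 4: "length s \<le> Suc (Suc M)" if "s \<in> set (lookup tab C)" "bounded_table M tab" for s tab C M
    using lookup_bounded[OF that(2,1)] by (simp add: bounded_solution_def)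
  have "ptime ?D (\<lambda>c. extend (fst c) (fst (snd c)) (fst (snd (snd c))) (snd (snd (snd c))))"
    unfolding extend_def
    by (intro ptime_let ptime_if ptime_bex ptime_map ptime_lookup ptime_reps ptime_component_of
        ptime_filter ptime_concat[where e = 1] ptime_basic)
      (auto intro!: pbounded_linear 1 3 le_trans[OF 2] le_trans[OF length_lookup]
        intro: le_trans[OF component_of_props(2)] 4)
  from ptime_comp[OF this ptime_Pair[OF assms(1) ptime_Pair[OF assms(2) ptime_Pair[OF assms(3,4)]]]] len
  show ?thesis by simp
qed


lemma ptime_improve:
  assumes "ptime D es" "ptime D Cs" "ptime D tab"
    and len: "\<And>M c. D M c \<Longrightarrow> length (es c) \<le> M \<and> length (Cs c) \<le> M \<and> (\<forall>C\<in>set (Cs c). length C \<le> M)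
      \<and> bounded_table M (tab c)"
  shows "ptime D (\<lambda>c. improve (es c) (Cs c) (tab c))"
proof -
  let ?D = "\<lambda>M (c :: (nat \<times> nat) list \<times> nat list list \<times> (nat list \<times> solution) list).
    length (fst c) \<le> M \<and> length (fst (snd c)) \<le> M \<and> (\<forall>C\<in>set (fst (snd c)). length C \<le> M)
      \<and> bounded_table M (snd (snd c))"
  have 1: "length (concat (map (\<lambda>r. map f (extend es tab C r)) rs)) \<le> Suc (Suc M)" if "length rs \<le> M"
    for f :: "solution \<Rightarrow> nat list \<times> solution" and es tab C rs M
    using length_concat_le[of "map (\<lambda>r. map f (extend es tab C r)) rs" 1] length_extend that
    by fastforce
  \<comment> \<open>A list with one solution has to fit into the bound \<open>M\<close>; the element
    \<open>r\<close> of a piece shows that \<open>M\<close> is positive.\<close>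
  have 2: "Suc 0 \<le> M" if "r \<in> set C" "C \<in> set Cs" "\<forall>C\<in>set Cs. length C \<le> M"
    for r :: nat and C Cs M
    using that by (cases C) auto
  have "ptime ?D (\<lambda>c. improve (fst c) (fst (snd c)) (snd (snd c)))"
    unfolding improve_def
    by (intro ptime_map ptime_concat[where e = 1] ptime_extend ptime_basic)
      (auto intro!: pbounded_linear 1 le_trans[OF length_extend] intro: 2)
  from ptime_comp[OF this ptime_Pair[OF assms(1) ptime_Pair[OF assms(2,3)]]] len
  show ?thesis by simp
qed

text \<open>\<open>k\<close> is a run-time value, so no fixed power of \<open>n\<close> bounds
  \<open>(n + 1) ^ k\<close>; the parameter \<open>M\<close> has to dominate it instead.\<close>

lemma ptime_complements:
  assumes "ptime D n" "ptime D k"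
    and len: "\<And>M c. D M c \<Longrightarrow> n c < M \<and> (n c + 1) ^ k c \<le> M \<and> k c \<le> M"
  shows "ptime D (\<lambda>c. complements (n c) (k c))"
proof -
  let ?D = "\<lambda>M c. fst c < M \<and> (fst c + 1) ^ snd c \<le> M \<and> snd c \<le> M"
  let ?D' = "\<lambda>M p. ?D M (fst p) \<and> length (snd (snd p)) \<le> M \<and> (\<forall>A\<in>set (snd (snd p)). length A \<le> M)"
  let ?g = "\<lambda>p :: (nat \<times> nat) \<times> nat \<times> nat list list.
    concat (map (\<lambda>A. map (\<lambda>s. filter (\<lambda>x. x \<noteq> s) A) [0..<fst (fst p) + 1]) (snd (snd p)))"
  have g: "ptime ?D' ?g"
    by (intro ptime_concat[where e = 1] ptime_map ptime_filter ptime_upt ptime_basic)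
      (auto intro!: pbounded_linear simp del: upt_Suc)
  have "ptime ?D (\<lambda>c. foldl (\<lambda>As x. ?g (c, x, As)) [[0..<fst c]] [0..<snd c])"
  \<comment> \<open>Counting the rounds left bounds the rounds done by \<open>k\<close>, so every
    intermediate list has at most \<open>(n + 1) ^ k\<close> members.\<close>
  proof (rule ptime_foldl_remaining[OF _ _ g,
        where I = "\<lambda>M c xs As. \<exists>j. As = complements (fst c) j \<and> length xs + j = snd c"])
    show "ptime ?D (\<lambda>c. [0..<snd c])" "ptime ?D (\<lambda>c. [[0..<fst c]])"
      by (intro ptime_upt ptime_basic; auto intro!: pbounded_linear)+
  next
    fix M x :: nat and c ys As
    assume D: "?D M c" and "\<exists>j. As = complements (fst c) j \<and> length (x # ys) + j = snd c"
    then obtain j where j: "As = complements (fst c) j" "Suc (length ys + j) = snd c" by auto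
    have "length As \<le> (fst c + 1) ^ snd c"
      unfolding j(1) length_complements by (rule power_increasing) (use j(2) in auto)
    moreover have "length A \<le> M" if "A \<in> set As" for A
      using complements_props that D unfolding j(1) by fastforce
    moreover have "?g (c, x, As) = complements (fst c) (Suc j)"
      unfolding complements_Suc j(1) by simp
    ultimately show "?D' M (c, x, As)
      \<and> (\<exists>j. ?g (c, x, As) = complements (fst c) j \<and> length ys + j = snd c)"
      using D j(2) by (intro conjI exI[of _ "Suc j"]) (auto simp del: upt_Suc)
  next
    fix M :: nat and c :: "nat \<times> nat"
    show "\<exists>j. [[0..<fst c]] = complements (fst c) j \<and> length [0..<snd c] + j = snd c"
      by (rule exI[of _ 0]) (simp add: complements_def)
  qed (auto intro!: pbounded_linear)
  then have "ptime ?D (\<lambda>c. complements (fst c) (snd c))"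
    by (simp add: complements_def del: upt_Suc)
  from ptime_comp[OF this ptime_Pair[OF assms(1,2)]] len show ?thesis by simp
qed

lemma ptime_pieces:
  assumes "ptime D n" "ptime D es" "ptime D k"
    and len: "\<And>M c. D M c \<Longrightarrow> n c < M \<and> (n c + 1) ^ k c \<le> M \<and> k c \<le> M \<and> length (es c) \<le> M"
  shows "ptime D (\<lambda>c. pieces (n c) (es c) (k c))"
proof -
  let ?D = "\<lambda>M c. fst c < M \<and> (fst c + 1) ^ snd (snd c) \<le> M \<and> snd (snd c) \<le> M
    \<and> length (fst (snd c)) \<le> M"
  have 1: "length A \<le> M" "length A \<le> Suc (Suc M)" if "A \<in> set (complements n k)" "n < M" for A n k M
    using complements_props[OF that(1)] that(2) by simp_all
  have "ptime ?D (\<lambda>c. pieces (fst c) (fst (snd c)) (snd (snd c)))"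
    unfolding pieces_def
    by (intro ptime_concat[where e = 1] ptime_map ptime_component_of ptime_complements ptime_basic)
      (auto intro!: pbounded_linear intro: 1 simp: length_complements)
  from ptime_comp[OF this ptime_Pair[OF assms(1) ptime_Pair[OF assms(2,3)]]] len
  show ?thesis by simp
qed

lemma length_improve:
  assumes "\<And>C. C \<in> set Cs \<Longrightarrow> length C \<le> n"
  shows "length (improve es Cs tab) \<le> length Cs * n"
  unfolding improve_def
proof (rule order_trans[OF length_concat_le[where b = n]])
  fix xs assume "xs \<in> set (map (\<lambda>C. concat (map (\<lambda>r. map (Pair C) (extend es tab C r)) C)) Cs)"
  then obtain C where C: "C \<in> set Cs" and xs: "xs = concat (map (\<lambda>r. map (Pair C) (extend es tab C r)) C)"
    by auto
  have "length xs \<le> length (map (\<lambda>r. map (Pair C) (extend es tab C r)) C) * 1"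
    unfolding xs by (rule length_concat_le) (use length_extend in auto)
  then show "length xs \<le> n" using assms[OF C] by simp
qed simp

text \<open>The invariant behind correctness also supplies the sizes: a solution has no more entries
  than its piece has vertices, and each entry lists distinct vertices.\<close>

context tree_instance
begin

lemma valid_bounded:
  assumes "valid_table (pieces n es k) tab" "length tab \<le> M" "n \<le> M"
  shows "bounded_table M tab"
  unfolding bounded_table_def bounded_solution_def
proof (intro conjI ballI)
  fix e assume e: "e \<in> set tab"
  then have C: "fst e \<in> set (pieces n es k)" and v: "valid (set (fst e)) (snd e)"
    using assms(1) unfolding valid_table_def by auto
  have len: "length (fst e) \<le> n" using pieces_props(4)[OF C] .
  then show "length (fst e) \<le> M" using assms(3) by simp
  have "length (snd e) \<le> card (set (fst e))" using v by (simp add: valid_def)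
  also have "\<dots> \<le> length (fst e)" by (rule card_length)
  finally show "length (snd e) \<le> M" using len assms(3) by simp
  fix p assume "p \<in> set (snd e)"
  then have p: "set (snd p) \<subseteq> V" "distinct (snd p)" using v by (auto simp: valid_def)
  then have "length (snd p) \<le> card V" by (metis card_mono distinct_card finite_lessThan)
  then show "length (snd p) \<le> M" using assms(3) by simp
qed (fact assms(2))

end

section \<open>The size parameter\<close>

text \<open>The product counts \<open>(n + 1) ^ k\<close> deleted sets, up to \<open>n\<close>
  pieces from each and up to \<open>n\<close> roots for each piece; it bounds the length of a table.
  The strict \<open>n < M\<close> makes room for the dummy number \<open>n\<close>.\<close>

definition feasible_size :: "nat \<Rightarrow> nat \<Rightarrow> nat \<Rightarrow> (nat \<times> nat) list \<Rightarrow> bool" where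
  "feasible_size M k n es \<longleftrightarrow> tree_input n es \<and> length es \<le> M \<and> k \<le> M \<and> n < M
     \<and> (n + 1) ^ k * n * n \<le> M"

lemma length_pieces_le: "length (pieces n es k) \<le> (n + 1) ^ k * n"
  unfolding pieces_def length_complements[symmetric]
  by (rule order_trans[OF length_concat_le[where b = n]]) (use complements_props in auto)

lemma feasible_size_pos: "feasible_size M k n es \<Longrightarrow> 0 < n"
  unfolding feasible_size_def using tree_instance.n_pos tree_instance.intro by blast

lemma feasible_size_bounds:
  assumes "feasible_size M k n es"
  shows "(n + 1) ^ k \<le> M" "length (pieces n es k) \<le> M" "length (pieces n es k) * n \<le> M"
proof -
  have n: "1 \<le> n" using feasible_size_pos[OF assms] by simp
  have M: "(n + 1) ^ k * n * n \<le> M" using assms by (simp add: feasible_size_def)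
  have "length (pieces n es k) * n \<le> (n + 1) ^ k * n * n"
    by (rule mult_right_mono[OF length_pieces_le]) simp
  then show 1: "length (pieces n es k) * n \<le> M" using M by linarith
  have "length (pieces n es k) * 1 \<le> length (pieces n es k) * n" using n by (rule mult_left_mono) simp
  then show "length (pieces n es k) \<le> M" using 1 by linarith
  have "(n + 1) ^ k * (1 * 1) \<le> (n + 1) ^ k * (n * n)"
    by (intro mult_left_mono mult_mono n) auto
  also have "\<dots> \<le> M" using M by (simp only: mult.assoc)
  finally show "(n + 1) ^ k \<le> M" by simp
qed

text \<open>The domain insists on the pieces of a tree because the size of the accumulator is
  controlled through the validity of its entries, which is established for such pieces.\<close>

lemma ptime_table:
  assumes "ptime D n" "ptime D es" "ptime D Cs"
    and len: "\<And>M c. D M c \<Longrightarrow> \<exists>k. Cs c = pieces (n c) (es c) k \<and> feasible_size M k (n c) (es c)"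
  shows "ptime D (\<lambda>c. table (n c) (es c) (Cs c))"
proof -
  let ?D = "\<lambda>M c. \<exists>k. snd (snd c) = pieces (fst c) (fst (snd c)) k \<and> feasible_size M k (fst c) (fst (snd c))"
  let ?D' = "\<lambda>M p. ?D M (fst p) \<and> bounded_table M (snd (snd p))"
  let ?g = "\<lambda>p :: (nat \<times> (nat \<times> nat) list \<times> nat list list) \<times> nat \<times> (nat list \<times> solution) list.
    improve (fst (snd (fst p))) (snd (snd (fst p))) (snd (snd p))"
  have short: "\<forall>C\<in>set (pieces n es k). length C \<le> n" for n es k
    using pieces_props(4) by blast
  have g: "ptime ?D' ?g"
  proof (rule ptime_improve)
    fix M :: nat and p :: "(nat \<times> (nat \<times> nat) list \<times> nat list list) \<times> nat \<times> (nat list \<times> solution) list"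
    assume "?D' M p"
    then obtain k where k: "snd (snd (fst p)) = pieces (fst (fst p)) (fst (snd (fst p))) k"
      and f: "feasible_size M k (fst (fst p)) (fst (snd (fst p)))" and b: "bounded_table M (snd (snd p))"
      by blast
    have "fst (fst p) < M" "length (fst (snd (fst p))) \<le> M" using f by (simp_all add: feasible_size_def)
    then show "length (fst (snd (fst p))) \<le> M \<and> length (snd (snd (fst p))) \<le> M
        \<and> (\<forall>C\<in>set (snd (snd (fst p))). length C \<le> M) \<and> bounded_table M (snd (snd p))"
      unfolding k using feasible_size_bounds(2)[OF f] b short[of "fst (fst p)"] by fastforce
  qed (intro ptime_basic)+
  let ?I = "\<lambda>M c tab. tree_instance.valid_table (fst c) (fst (snd c)) (snd (snd c)) tab \<and> length tab \<le> M"
  have "ptime ?D (\<lambda>c. foldl (\<lambda>tab x. ?g (c, x, tab)) [] [0..<fst c])"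
  proof (rule ptime_foldl[OF _ _ g, where I = ?I])
    show "ptime ?D (\<lambda>c. [0..<fst c])" "ptime ?D (\<lambda>c. [])"
      by (intro ptime_upt ptime_basic; auto intro!: pbounded_linear simp: feasible_size_def)+
    show "pbounded ?D (\<lambda>c. length [0..<fst c])"
      by (auto intro!: pbounded_linear simp: feasible_size_def)
  next
    fix M :: nat and c :: "nat \<times> (nat \<times> nat) list \<times> nat list list" assume "?D M c"
    then interpret tree_instance "fst c" "fst (snd c)"
      by unfold_locales (auto simp: feasible_size_def)
    show "?I M c []" by (simp add: valid_table_def)
  next
    fix M x :: nat and c :: "nat \<times> (nat \<times> nat) list \<times> nat list list" and tab
    assume D: "?D M c" and I: "?I M c tab"
    then obtain k where k: "snd (snd c) = pieces (fst c) (fst (snd c)) k"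
      and f: "feasible_size M k (fst c) (fst (snd c))" by blast
    interpret tree_instance "fst c" "fst (snd c)"
      by unfold_locales (use f in \<open>simp add: feasible_size_def\<close>)
    have b: "bounded_table M tab"
      by (rule valid_bounded[of k]) (use I k f in \<open>auto simp: feasible_size_def\<close>)
    have "length (?g (c, x, tab)) \<le> length (snd (snd c)) * fst c"
      using length_improve[of "snd (snd c)" "fst c"] short k by simp
    also have "\<dots> \<le> M" using feasible_size_bounds(3)[OF f] k by simp
    finally have "length (?g (c, x, tab)) \<le> M" .
    moreover have "valid_table (snd (snd c)) (?g (c, x, tab))"
      using valid_improve[of k tab] I k by simp
    ultimately show "?D' M (c, x, tab) \<and> ?I M c (?g (c, x, tab))" using D b by simp
  qed
  then have "ptime ?D (\<lambda>c. table (fst c) (fst (snd c)) (snd (snd c)))"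
    by (simp add: table_def)
  from ptime_comp[OF this ptime_Pair[OF assms(1) ptime_Pair[OF assms(2,3)]]] len
  show ?thesis by simp
qed


lemma ptime_labels:
  assumes "ptime D n" "ptime D s" and len: "\<And>M c. D M c \<Longrightarrow> n c \<le> M \<and> bounded_solution M (s c)"
  shows "ptime D (\<lambda>c. labels (n c) (s c))"
proof -
  have "ptime (\<lambda>M c. fst c \<le> M \<and> bounded_solution M (snd c)) (\<lambda>c. labels (fst c) (snd c))"
    unfolding labels_def
    by (intro ptime_map ptime_filter ptime_bex ptime_upt ptime_basic)
      (auto intro!: pbounded_linear intro: le_trans[OF length_filter_le] simp: bounded_solution_def)
  from ptime_comp[OF this ptime_Pair[OF assms(1,2)]] len show ?thesis by simp
qed

lemma ptime_hub_algorithm: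
  "ptime (\<lambda>M c. feasible_size M (fst c) (fst (snd c)) (snd (snd c)))
    (\<lambda>c. hub_algorithm (fst c) (fst (snd c)) (snd (snd c)))"
proof -
  have bt: "bounded_table M (table n es (pieces n es k))" if f: "feasible_size M k n es" for M k n es
  proof -
    interpret tree_instance n es by unfold_locales (use f in \<open>simp add: feasible_size_def\<close>)
    let ?it = "\<lambda>i. (improve es (pieces n es k) ^^ i) []"
    have "length (?it i) \<le> M" for i
    proof (cases i)
      case (Suc j)
      have "length (?it i) \<le> length (pieces n es k) * n"
        unfolding Suc funpow.simps comp_def by (rule length_improve) (rule pieces_props(4))
      then show ?thesis using feasible_size_bounds(3)[OF f] by linarith
    qed simp
    then show ?thesis
      unfolding table_eq using valid_bounded[OF valid_iterate] f by (simp add: feasible_size_def)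
  qed
  have bl: "bounded_solution M (hd (lookup (table n es (pieces n es k)) L))"
    if "feasible_size M k n es" "lookup (table n es (pieces n es k)) L \<noteq> []" for M k n es L
    by (rule lookup_bounded[OF bt[OF that(1)] hd_in_set[OF that(2)]])
  have fs: "n < M" "n \<le> M" "k \<le> M" "length es \<le> M" "Suc n ^ k \<le> M" if "feasible_size M k n es" for M k n es
    using that feasible_size_bounds(1)[OF that] by (auto simp: feasible_size_def)
  have nil: "bounded_solution M []" for M by (simp add: bounded_solution_def)
  show ?thesis
    unfolding hub_algorithm_def
    by (intro ptime_let ptime_labels ptime_if ptime_hd ptime_lookup ptime_table ptime_pieces ptime_upt ptime_basic)
      (auto intro!: pbounded_linear bt intro: bl fs nil)
qed


text \<open>The term \<open>(n + 1) ^ k * n * n\<close> suggests the exponent \<open>k + 2\<close>.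
  The summand 2 costs one more factor \<open>n + 1\<close>, and \<open>n + 1 \<le> n ^ 2\<close>
  changes the base to \<open>n\<close>; that inequality fails for \<open>n = 1\<close>.\<close>

lemma feasible_size_exists:
  assumes "tree_input n es" "2 \<le> n"
  shows "\<exists>M. feasible_size M k n es \<and> M + 2 \<le> n ^ (2 * (k + 3))"
proof (intro exI conjI)
  interpret tree_instance n es by unfold_locales (fact assms(1))
  let ?M = "(n + 1) ^ (k + 2)"
  have sq: "n * n \<le> (n + 1) ^ 2" by (simp add: power2_eq_square)
  have pos: "1 \<le> (n + 1) ^ k" by simp
  have M: "?M = (n + 1) ^ k * (n + 1) ^ 2" by (rule power_add)
  have le: "(n + 1) ^ 2 \<le> ?M" unfolding M by simp
  have "n < (n + 1) ^ 2" by (simp add: power2_eq_square)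
  moreover have "k < 2 ^ k" by (rule less_exp)
  moreover have "(2 :: nat) ^ k \<le> (n + 1) ^ k" using assms(2) by (intro power_mono) auto
  moreover have "(n + 1) ^ k \<le> ?M" by (rule power_increasing) auto
  moreover have "(n + 1) ^ k * n * n \<le> ?M"
    unfolding M mult.assoc by (rule mult_left_mono[OF sq]) simp
  ultimately show "feasible_size ?M k n es"
    unfolding feasible_size_def using length_es sq le assms(1) by linarith
  have "(n + 1) ^ 1 \<le> ?M" by (rule power_increasing) auto
  then have "?M + 2 \<le> 2 * ?M" using assms(2) by simp
  also have "\<dots> \<le> (n + 1) * ?M" by (rule mult_right_mono) (use assms(2) in auto)
  also have "\<dots> = (n + 1) ^ (k + 3)" by (simp add: numeral_3_eq_3)
  also have "\<dots> \<le> (n ^ 2) ^ (k + 3)"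
  proof (rule power_mono)
    have "n + 1 \<le> 2 * n" using assms(2) by simp
    also have "\<dots> \<le> n * n" using assms(2) by (intro mult_right_mono) auto
    finally show "n + 1 \<le> n ^ 2" by (simp add: power2_eq_square)
  qed simp
  also have "\<dots> = n ^ (2 * (k + 3))" by (rule power_mult[symmetric])
  finally show "?M + 2 \<le> n ^ (2 * (k + 3))" .
qed

text \<open>The label computed for vertex 0 is a nonempty subset of \<open>{0}\<close>. So the fixed
  answer agrees with the algorithm and inherits its guarantee, without evaluating the
  optimum.\<close>

lemma single_vertex:
  assumes "tree_input 1 es"
  shows "hub_labeling {..<1} (edge_set es) (labels_of [[0]])"
    "q * hl1_cost {..<1} (labels_of [[0]]) \<le> (q + 1) * hl1_opt {..<1} (edge_set es)"
proof -
  interpret tree_instance 1 es by unfold_locales (fact assms)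
  let ?hs = "hub_algorithm (2 * q + 2) 1 es"
  note correct = hub_algorithm_correct[of q]
  have "labels_of ?hs 0 \<subseteq> {..<1}" "labels_of ?hs 0 \<noteq> {}"
    using correct(2) unfolding hub_labeling_def by auto
  then have "labels_of ?hs 0 = {0}" by (auto simp: lessThan_Suc)
  then have eq: "labels_of ?hs 0 = labels_of [[0]] 0" by (simp add: labels_of_def)
  then show "hub_labeling {..<1} (edge_set es) (labels_of [[0]])"
    using correct(2) by (simp add: hub_labeling_def)
  show "q * hl1_cost {..<1} (labels_of [[0]]) \<le> (q + 1) * hl1_opt {..<1} (edge_set es)"
    using correct(3) eq by (simp add: hl1_cost_def)
qed

section \<open>The main program\<close>

lemma enc_tree_eq: "enc_tree n es = enc (n, es)"
proof -
  have "enc_list (\<lambda>(u, v). VPair (VNum u) (VNum v)) es = enc es" for es :: "(nat \<times> nat) list"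
    by (induction es) (auto simp: enc_nat_def)
  then show ?thesis by (simp add: enc_tree_def enc_nat_def)
qed

lemma enc_labels_eq: "enc_labels hs = enc hs"
proof -
  have "enc_list VNum xs = enc xs" for xs :: "nat list"
    by (induction xs) (auto simp: enc_nat_def)
  then show ?thesis
    unfolding enc_labels_def by (induction hs) simp_all
qed

text \<open>
  A tree with one vertex is answered directly: there the time bound \<open>C * n powr (c / \<epsilon>)\<close> is
  just \<open>C\<close>, independently of \<open>\<epsilon>\<close>.
\<close>

definition main_body :: "nat \<Rightarrow> expr \<Rightarrow> expr" where
  "main_body k b = EIf (ELess (EFst (EVar 0)) (ENum 2))
     (EPair (EPair (ENum 0) (ENum 0)) (ENum 0))
     (ELet (EPair (ENum k) (EVar 0)) b)"

lemma eval_main_guard: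
  "eval_within P [enc_tree n es] (ELess (EFst (EVar 0)) (ENum 2)) (VNum (if n < 2 then 1 else 0)) 4"
proof -
  have v: "eval_within P [enc_tree n es] (EVar 0) (VPair (VNum n) (enc es)) 1"
    using eval_within_Var[of 0 "[enc_tree n es]"] by (simp add: enc_tree_eq enc_nat_def)
  show ?thesis
    by (rule eval_within_mono[OF eval_within_Less[OF eval_within_Fst[OF v] eval_within_Num]]) simp
qed

lemma eval_main_single:
  assumes "n < 2"
  shows "eval_within P [enc_tree n es] (main_body k b) (enc_labels [[0]]) 10"
proof -
  have "eval_within P [enc_tree n es] (EPair (EPair (ENum 0) (ENum 0)) (ENum 0)) (enc_labels [[0]])
      (1 + 1 + 1 + 1 + 1)"
    using eval_within_Pair[OF eval_within_Pair[OF eval_within_Num[of _ _ 0] eval_within_Num[of _ _ 0]]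
        eval_within_Num[of _ _ 0]]
    by (simp add: enc_labels_eq enc_nat_def)
  then have "eval_within P [enc_tree n es] (main_body k b) (enc_labels [[0]]) (4 + (1 + 1 + 1 + 1 + 1) + 1)"
    unfolding main_body_def by (intro eval_within_If[OF eval_main_guard]) (use assms in auto)
  then show ?thesis by simp
qed

text \<open>The block \<open>R\<close> is generated for position 1, because function 0 is the main
  body.\<close>

lemma eval_main_algorithm:
  assumes "2 \<le> n" and R: "realizes 1 R D d f b" and D: "D M (k, n, es)"
  shows "eval_within (main_body k b # R) [enc_tree n es] (main_body k b) (enc (f (k, n, es)))
    ((M + 2) ^ d + 9)"
proof -
  let ?P = "main_body k b # R"
  have "eval_within ?P [enc_tree n es] (EPair (ENum k) (EVar 0)) (enc (k, n, es)) (1 + 1 + 1)"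
    using eval_within_Pair[OF eval_within_Num eval_within_Var[of 0 "[enc_tree n es]"]]
    by (simp add: enc_tree_eq enc_nat_def)
  moreover have "eval_within ?P [enc (k, n, es), enc_tree n es] b (enc (f (k, n, es))) ((M + 2) ^ d)"
    using realizesD[OF R, of "[main_body k b]" M "(k, n, es)" "[]"] D by simp
  ultimately have "eval_within ?P [enc_tree n es] (ELet (EPair (ENum k) (EVar 0)) b) (enc (f (k, n, es)))
      (1 + 1 + 1 + (M + 2) ^ d + 1)"
    by (rule eval_within_Let)
  then have "eval_within ?P [enc_tree n es] (main_body k b) (enc (f (k, n, es)))
      (4 + (1 + 1 + 1 + (M + 2) ^ d + 1) + 1)"
    unfolding main_body_def[of k b] by (intro eval_within_If[OF eval_main_guard]) (use assms(1) in auto)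
  then show ?thesis by (rule eval_within_mono) simp
qed

theorem mainTheorem4:
  shows "\<exists>C c :: real. \<forall>\<epsilon> :: real. 0 < \<epsilon> \<and> \<epsilon> < 1 \<longrightarrow>
    (\<exists>P :: program. \<forall>n es. tree_input n es \<longrightarrow>
      (\<exists>hs t. run_program P (enc_tree n es) (enc_labels hs) t
        \<and> length hs = n
        \<and> hub_labeling {..<n} (edge_set es) (labels_of hs)
        \<and> real (hl1_cost {..<n} (labels_of hs)) \<le> (1 + \<epsilon>) * real (hl1_opt {..<n} (edge_set es))
        \<and> real t \<le> C * real n powr (c / \<epsilon>)))"
proof -
  \<comment> \<open>Code and degree are fixed before \<epsilon>; only the numeral \<open>?k\<close>
    inside \<open>main_body\<close> will depend on it.\<close>
  obtain d R b where R: "realizes 1 R (\<lambda>M c. feasible_size M (fst c) (fst (snd c)) (snd (snd c))) d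
      (\<lambda>c. hub_algorithm (fst c) (fst (snd c)) (snd (snd c))) b"
    using ptime_hub_algorithm unfolding ptime_def by blast
  show ?thesis
  \<comment> \<open>The 10 covers the direct answer for one vertex and turns
    \<open>n ^ ?x + 9\<close> into a multiple of \<open>n ^ ?x\<close>. The 18 comes from
    \<open>2 * (?k + 3) = 4 * q + 10\<close>, which is at most
    \<open>8 / \<epsilon> + 10 \<le> 18 / \<epsilon>\<close>.\<close>
  proof (rule exI[of _ 10], rule exI[of _ "18 * real d"], intro allI impI)
    fix \<epsilon> :: real assume eps: "0 < \<epsilon> \<and> \<epsilon> < 1"
    \<comment> \<open>Rounding up makes \<open>1 + 1 / q\<close> at most
      \<open>1 + \<epsilon>\<close>; as \<open>1 / \<epsilon>\<close> exceeds 1, it at most doubles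
      the value.\<close>
    define q where "q = nat \<lceil>1 / \<epsilon>\<rceil>"
    have q1: "1 / \<epsilon> \<le> real q" "real q \<le> 2 / \<epsilon>" "0 < q"
    proof -
      have "1 \<le> 1 / \<epsilon>" using eps by simp
      then show "1 / \<epsilon> \<le> real q" "0 < q" unfolding q_def by linarith+
      have "real q \<le> 1 / \<epsilon> + 1" using \<open>1 \<le> 1 / \<epsilon>\<close> unfolding q_def by linarith
      then show "real q \<le> 2 / \<epsilon>" using \<open>1 \<le> 1 / \<epsilon>\<close> by simp
    qed
    let ?k = "2 * q + 2"
    have approx: "real x \<le> (1 + \<epsilon>) * real y" if "q * x \<le> (q + 1) * y" for x y
    proof -
      have "real q * real x \<le> (real q + 1) * real y"
        using of_nat_mono[OF that, where 'a = real] by (simp add: algebra_simps)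
      also have "\<dots> \<le> (real q + \<epsilon> * real q) * real y"
        using q1(1) eps by (intro mult_right_mono) (auto simp: field_simps)
      also have "\<dots> = real q * ((1 + \<epsilon>) * real y)" by (simp add: algebra_simps)
      finally show ?thesis using q1(3) by simp
    qed
    let ?P = "main_body ?k b # R"
    have run: "\<exists>t\<le>B. run_program ?P (enc_tree n es) (enc_labels hs) t"
      if "eval_within ?P [enc_tree n es] (main_body ?k b) (enc_labels hs) B" for n es hs B
      using that by (auto simp: run_program_def eval_within_def)
    show "\<exists>P :: program. \<forall>n es. tree_input n es \<longrightarrow>
      (\<exists>hs t. run_program P (enc_tree n es) (enc_labels hs) t
        \<and> length hs = n
        \<and> hub_labeling {..<n} (edge_set es) (labels_of hs)
        \<and> real (hl1_cost {..<n} (labels_of hs)) \<le> (1 + \<epsilon>) * real (hl1_opt {..<n} (edge_set es))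
        \<and> real t \<le> 10 * real n powr (18 * real d / \<epsilon>))"
    proof (intro exI[of _ ?P] allI impI)
      fix n es assume tree: "tree_input n es"
      interpret tree_instance n es by unfold_locales (fact tree)
      show "\<exists>hs t. run_program ?P (enc_tree n es) (enc_labels hs) t
        \<and> length hs = n
        \<and> hub_labeling {..<n} (edge_set es) (labels_of hs)
        \<and> real (hl1_cost {..<n} (labels_of hs)) \<le> (1 + \<epsilon>) * real (hl1_opt {..<n} (edge_set es))
        \<and> real t \<le> 10 * real n powr (18 * real d / \<epsilon>)"
      proof (cases "n < 2")
        case True
        then have n: "n = 1" using n_pos by simp
        obtain t where "t \<le> 10" "run_program ?P (enc_tree n es) (enc_labels [[0]]) t"
          using run[OF eval_main_single[OF True]] by blast
        then show ?thesis
          using single_vertex(1)[of es] single_vertex(2)[of es q] tree approx n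
          by (intro exI[of _ "[[0]]"] exI[of _ t]) simp
      next
        case False
        then have n: "2 \<le> n" by simp
        obtain M where M: "feasible_size M ?k n es" "M + 2 \<le> n ^ (2 * (?k + 3))"
          using feasible_size_exists[OF tree n] by blast
        let ?hs = "hub_algorithm ?k n es"
        have "eval_within ?P [enc_tree n es] (main_body ?k b) (enc_labels ?hs) ((M + 2) ^ d + 9)"
          using eval_main_algorithm[OF n R, of M ?k es] M(1) by (simp add: enc_labels_eq)
        then obtain t where t: "t \<le> (M + 2) ^ d + 9" "run_program ?P (enc_tree n es) (enc_labels ?hs) t"
          using run by blast
        let ?x = "2 * (?k + 3) * d"
        have "(M + 2) ^ d \<le> (n ^ (2 * (?k + 3))) ^ d" by (rule power_mono[OF M(2)]) simp
        also have "\<dots> = n ^ ?x" by (rule power_mult[symmetric])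
        finally have "t \<le> n ^ ?x + 9" using t(1) by linarith
        moreover have "1 \<le> n ^ ?x" using n by simp
        ultimately have "t \<le> 10 * n ^ ?x" by linarith
        then have "real t \<le> 10 * real n ^ ?x" using of_nat_mono[of t "10 * n ^ ?x", where 'a = real] by simp
        also have "real n ^ ?x = real n powr real ?x" by (rule powr_realpow[symmetric]) (use n in simp)
        also have "real n powr real ?x \<le> real n powr (18 * real d / \<epsilon>)"
        proof (rule powr_mono)
          have "1 \<le> 1 / \<epsilon>" using eps by simp
          then have "real (2 * (?k + 3)) \<le> 18 / \<epsilon>" using q1(2) by simp
          then have "real (2 * (?k + 3)) * real d \<le> 18 / \<epsilon> * real d" by (rule mult_right_mono) simp
          then show "real ?x \<le> 18 * real d / \<epsilon>" by simp
        qed (use n in simp)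
        finally have "real t \<le> 10 * real n powr (18 * real d / \<epsilon>)" by simp
        then show ?thesis
          using t(2) hub_algorithm_correct[of q] approx by (intro exI[of _ ?hs] exI[of _ t]) blast
      qed
    qed
  qed
qed

end
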